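(* Let $\sigma_{\widehat{\mathrm{mex}}}(n)$ denote the sum of $\widehat{\mathrm{mex}}(\pi)$ over all overpartitions $\pi$ of $n$. Then \[\sigma_{\widehat{\mathrm{mex}}}(n)\sim \frac{e^{\pi\sqrt{n}}}{4n}\quad\text{as } n\to\infty.\]
   Context: An overpartition of a positive integer $n$ is a non-increasing sequence of positive integers summing to $n$ in which the first occurrence of each number may (or may not) be overlined. For an overpartition $\pi$, $\widehat{\mathrm{mex}}(\pi)$ is the smallest positive integer that does not occur as an overlined part of $\pi$. *)

theory Defs
  imports Complex_Main "HOL-Library.Landau_Symbols"
begin

text \<open>
  An overpartition is a list of pairs consisting of a part and a flag telling whether that
  occurrence of the part is overlined.
\<close>

definition overpartition :: "nat \<Rightarrow> (nat \<times> bool) list \<Rightarrow> bool" where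
  "overpartition n p \<longleftrightarrow>
     sorted_wrt (\<ge>) (map fst p) \<and>
     (\<forall>x\<in>set p. fst x > 0) \<and>
     sum_list (map fst p) = n \<and>
     (\<forall>i<length p. snd (p ! i) \<longrightarrow> (\<forall>j<i. fst (p ! j) \<noteq> fst (p ! i)))"

definition overlined_mex :: "(nat \<times> bool) list \<Rightarrow> nat" where
  "overlined_mex p = (LEAST m. m > 0 \<and> (m, True) \<notin> set p)"

definition sigma_overlined_mex :: "nat \<Rightarrow> nat" where
  "sigma_overlined_mex n = (\<Sum>p | overpartition n p. overlined_mex p)"

text \<open>Hence the sum above ranges over a finite set and does not collapse to the default 0.\<close>

lemma finite_overpartitions: "finite {p. overpartition n p}"
proof -
  have len: "length p \<le> sum_list (map fst p)" if "\<forall>x\<in>set p. fst x > 0"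
    for p :: "(nat \<times> bool) list"
    using that by (induction p) auto
  have "set p \<subseteq> {..n} \<times> UNIV \<and> length p \<le> n" if "overpartition n p" for p
  proof
    have "fst x \<le> n" if "x \<in> set p" for x
      using \<open>overpartition n p\<close> that member_le_sum_list[of "fst x" "map fst p"]
      by (auto simp: overpartition_def)
    then show "set p \<subseteq> {..n} \<times> UNIV" by (auto simp: mem_Times_iff)
    show "length p \<le> n"
      using \<open>overpartition n p\<close> len by (auto simp: overpartition_def)
  qed
  then have "{p. overpartition n p} \<subseteq> {p. set p \<subseteq> {..n} \<times> UNIV \<and> length p \<le> n}" by blast
  then show ?thesis
    by (rule finite_subset) (intro finite_lists_length_le finite_cartesian_product; simp)
qed

end

theory Submission
  imports Defs "HOL-Probability.Probability" "HOL-Complex_Analysis.Complex_Analysis" "HOL-Real_Asymp.Real_Asymp"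
begin

text \<open>
  The number of overpartitions of \<open>n\<close> with mex exceeding \<open>m\<close> counts those in which all of
  \<open>1, \<dots>, m\<close> are overlined. Removing the overlined part \<open>m\<close> shows that this number is at most
  \<open>2\<^sup>-\<^sup>m\<close> times the number \<open>p n\<close> of all overpartitions of \<open>n\<close>, and, if \<open>p (n + 1) / p n\<close> tends
  to 1, asymptotic to that bound. Summing over \<open>m\<close> by Tannery's theorem, the sum of the mex is
  asymptotic to \<open>2 * p n\<close>.

  It remains to see that \<open>p n\<close> is asymptotic to \<open>exp (pi * sqrt n) / (8 * n)\<close>. The logarithm \<open>L\<close> of
  the generating function is the sum of \<open>(2 / k) * q ^ k / (1 - q ^ k)\<close> over odd \<open>k\<close>, and also the sum
  of \<open>ln (coth (n * t / 2))\<close> over \<open>n > 0\<close> if \<open>q = exp (- t)\<close>. In the second form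
  \<open>L (exp (- t)) - 2 * L (exp (- 2 * t))\<close> is an alternating sum of a convex function which Wallis' product
  evaluates up to \<open>o(1)\<close>; this yields \<open>L (exp (- t)) = pi\<^sup>2 / (4 * t) + ln (t / (4 * pi)) / 2 + o(1)\<close>. In
  Cauchy's integral over the circle of radius \<open>exp (- t)\<close> with \<open>t = pi / (2 * sqrt n)\<close> the angle is
  rescaled by \<open>t powr (3 / 2)\<close>; the integrand then tends to a Gaussian, and is dominated on the whole
  circle because each summand of the first form of \<open>L\<close> has its largest real part at the positive \<open>q\<close>, so
  that the term \<open>k = 1\<close> alone controls the decay.
\<close>

section \<open>Overpartitions as multisets\<close>

text \<open>The integral needs the factor in front of exp (pi^2 / (4 * t)) exactly, which is usually
  read off from the modular transformation of the eta function. The doubling relation replaces it: a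
  term c / t cancels in L (exp (- t)) - 2 * L (exp (- 2 * t)), and the rest, being o(1 / t), is
  determined by the relation up to o(1). As L (exp (- t)) is about pi^2 / (4 * t), its second
  derivative is about pi^2 / (2 * t^3), hence the angular scale; the exponent n * t + L is
  stationary at n = pi^2 / (4 * t^2), hence the choice of t. The constant 8 arises from 2 * pi * p n
  ~ exp (n * t + pi^2 / (4 * t)) * sqrt (t / (4 * pi)) * t powr (3 / 2) * 2 / sqrt pi, whose
  algebraic part is t^2 / pi = pi / (4 * n). No Gaussian majorant holds on the whole circle: at
  angles of order 1 the exponent is only of order - 1 / t, while v^2 is of order 1 / t^3 in the
  rescaled angle v. A multiple of 1 / (1 + v^2) does hold and suffices for dominated convergence, so
  no minor arcs are split off.\<close>

definition positive_parts :: "(nat \<times> bool) set" where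
  "positive_parts = {x. fst x > 0}"

text \<open>A multiset forgets the order of the list, and the condition on first occurrences becomes
  a multiplicity of at most one for each overlined pair. The set \<open>A\<close> of admissible
  pairs is a parameter so that recurrences can remove one pair at a time.\<close>

definition ovp_msets :: "(nat \<times> bool) set \<Rightarrow> nat \<Rightarrow> (nat \<times> bool) multiset set" where
  "ovp_msets A n = {M. set_mset M \<subseteq> A \<and> (\<forall>k. count M (k, True) \<le> 1) \<and> sum_mset (image_mset fst M) = n}"

definition ovp_count :: "(nat \<times> bool) set \<Rightarrow> nat \<Rightarrow> nat" where
  "ovp_count A n = card (ovp_msets A n)"

definition part_rel :: "nat \<times> bool \<Rightarrow> nat \<times> bool \<Rightarrow> bool" where
  "part_rel x y \<longleftrightarrow> fst y < fst x \<or> (fst x = fst y \<and> \<not> snd y)"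

text \<open>A linear key with 2 * k + 1 for the overlined and 2 * k for the plain copy of
  \<open>k\<close>: in decreasing order of keys the overlined copy precedes the plain ones of equal
  size.\<close>

definition part_key :: "nat \<times> bool \<Rightarrow> nat" where
  "part_key x = 2 * fst x + of_bool (snd x)"

lemma inj_part_key: "inj part_key"
proof (rule injI)
  fix x y assume "part_key x = part_key y"
  then have "2 * fst x + of_bool (snd x) = 2 * fst y + (of_bool (snd y) :: nat)"
    by (simp add: part_key_def)
  then have "fst x = fst y \<and> snd x = snd y"
    by (cases "snd x"; cases "snd y") (simp_all, presburger+)
  then show "x = y" by (simp add: prod_eq_iff)
qed

lemma overpartition_iff_part_rel:
  "overpartition n p \<longleftrightarrow>
     sorted_wrt part_rel p \<and> set p \<subseteq> positive_parts \<and> sum_list (map fst p) = n"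
proof -
  have rel: "part_rel x y \<longleftrightarrow> fst x \<ge> fst y \<and> (snd y \<longrightarrow> fst x \<noteq> fst y)" for x y
    by (auto simp: part_rel_def)
  have "sorted_wrt part_rel p \<longleftrightarrow> sorted_wrt (\<ge>) (map fst p) \<and>
      (\<forall>i<length p. snd (p ! i) \<longrightarrow> (\<forall>j<i. fst (p ! j) \<noteq> fst (p ! i)))"
    unfolding sorted_wrt_map sorted_wrt_iff_nth_less rel by (auto dest: less_trans)
  then show ?thesis
    unfolding overpartition_def positive_parts_def by auto
qed

text \<open>\<open>part_rel\<close> is the decreasing key order made irreflexive exactly at
  overlined pairs, and irreflexivity at a pair forbids its repetition.\<close>

lemma sorted_part_rel_iff:
  "sorted_wrt part_rel p \<longleftrightarrow>
     sorted_wrt (\<lambda>x y. part_key y \<le> part_key x) p \<and> (\<forall>k. count (mset p) (k, True) \<le> 1)"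
proof (induction p)
  case (Cons x p)
  have rel: "part_rel x y \<longleftrightarrow> part_key y \<le> part_key x \<and> \<not> (x = y \<and> snd x)" for y
    by (cases x; cases y) (auto simp: part_rel_def part_key_def)
  have "(\<forall>y\<in>set p. \<not> (x = y \<and> snd x)) \<longleftrightarrow> (snd x \<longrightarrow> count (mset p) x = 0)"
    by (auto simp: count_eq_zero_iff)
  moreover have "(\<forall>k. count (mset (x # p)) (k, True) \<le> 1) \<longleftrightarrow>
      (snd x \<longrightarrow> count (mset p) x = 0) \<and> (\<forall>k. count (mset p) (k, True) \<le> 1)"
    by (cases x) (auto simp: le_Suc_eq)
  ultimately show ?case using Cons by (auto simp: rel)
qed simp

text \<open>An injective key admits only one sorted arrangement of a multiset, which gives
  injectivity; sorting any enumeration by the key and reversing it gives surjectivity.\<close>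

lemma bij_betw_mset_overpartitions:
  "bij_betw mset {p. overpartition n p} (ovp_msets positive_parts n)"
proof (rule bij_betwI')
  fix p q assume pq: "p \<in> {p. overpartition n p}" "q \<in> {p. overpartition n p}"
  show "mset p = mset q \<longleftrightarrow> p = q"
  proof
    assume eq: "mset p = mset q"
    have *: "sorted (map part_key (rev r))" if "overpartition n r" for r
      using that
      by (simp add: overpartition_iff_part_rel sorted_part_rel_iff sorted_wrt_map sorted_wrt_rev)
    have "mset (map part_key (rev p)) = mset (map part_key (rev q))"
      using eq by simp
    moreover have "sorted (map part_key (rev p))" "sorted (map part_key (rev q))"
      using pq * by blast+
    ultimately have "map part_key (rev p) = map part_key (rev q)"
      by (metis properties_for_sort)
    then show "p = q" using inj_map_eq_map[OF inj_part_key] by (metis rev_rev_ident)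
  qed simp
next
  fix p assume "p \<in> {p. overpartition n p}"
  then show "mset p \<in> ovp_msets positive_parts n"
    by (auto simp: overpartition_iff_part_rel sorted_part_rel_iff ovp_msets_def simp flip: mset_map sum_mset_sum_list)
next
  fix M assume M: "M \<in> ovp_msets positive_parts n"
  obtain xs where xs: "mset xs = M" using ex_mset by blast
  define p where "p = rev (sort_key part_key xs)"
  have mp: "mset p = M" by (simp add: p_def xs)
  have "sorted_wrt (\<lambda>x y. part_key y \<le> part_key x) p"
    using sorted_sort_key[of part_key xs] by (simp add: p_def sorted_wrt_rev sorted_wrt_map)
  then have "overpartition n p"
    using M mp by (auto simp: overpartition_iff_part_rel sorted_part_rel_iff ovp_msets_def simp flip: mset_map sum_mset_sum_list)
  then show "\<exists>p\<in>{p. overpartition n p}. M = mset p" using mp by blast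
qed

lemma finite_ovp_msets:
  assumes "A \<subseteq> positive_parts"
  shows "finite (ovp_msets A n)"
proof (rule finite_subset)
  show "ovp_msets A n \<subseteq> ovp_msets positive_parts n"
    using assms by (auto simp: ovp_msets_def)
  show "finite (ovp_msets positive_parts n)"
    using bij_betw_finite[OF bij_betw_mset_overpartitions] finite_overpartitions by blast
qed

text \<open>Split according to whether \<open>(k, True)\<close> occurs. It occurs at most once, so
  what remains after its removal avoids the pair; in generating functions this is the factor 1 + q ^
  k.\<close>

lemma ovp_count_remove_overlined:
  assumes A: "A \<subseteq> positive_parts" and x: "(k, True) \<in> A"
  defines "A' \<equiv> A - {(k, True)}"
  shows "ovp_count A n = ovp_count A' n + (if k \<le> n then ovp_count A' (n - k) else 0)"
proof -
  let ?f = "add_mset (k, True)"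
  have eq: "ovp_msets A n = ovp_msets A' n \<union> (if k \<le> n then ?f ` ovp_msets A' (n - k) else {})"
  proof (intro equalityI subsetI)
    fix M assume M: "M \<in> ovp_msets A n"
    show "M \<in> ovp_msets A' n \<union> (if k \<le> n then ?f ` ovp_msets A' (n - k) else {})"
    proof (cases "(k, True) \<in># M")
      case True
      then obtain N where N: "M = ?f N" by (metis insert_DiffM)
      have "count M (k, True) \<le> 1" using M by (auto simp: ovp_msets_def)
      then have "(k, True) \<notin># N" using N by (auto simp: not_in_iff)
      moreover have "count N (j, True) \<le> 1" for j
      proof -
        have "count N (j, True) \<le> count M (j, True)" by (simp add: N)
        also have "\<dots> \<le> 1" using M by (auto simp: ovp_msets_def)
        finally show ?thesis .
      qed
      ultimately have "N \<in> ovp_msets A' (n - k)" "k \<le> n"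
        using M N by (auto simp: ovp_msets_def A'_def)
      then show ?thesis using N by auto
    next
      case False
      then show ?thesis using M by (auto simp: ovp_msets_def A'_def)
    qed
  next
    fix M assume M: "M \<in> ovp_msets A' n \<union> (if k \<le> n then ?f ` ovp_msets A' (n - k) else {})"
    show "M \<in> ovp_msets A n"
    proof (cases "M \<in> ovp_msets A' n")
      case True
      then show ?thesis by (auto simp: ovp_msets_def A'_def)
    next
      case False
      then obtain N where N: "M = ?f N" "N \<in> ovp_msets A' (n - k)" "k \<le> n"
        using M by (auto split: if_splits)
      have "count N (k, True) = 0"
        using N(2) by (auto simp: ovp_msets_def A'_def count_eq_zero_iff)
      then show ?thesis using N x by (auto simp: ovp_msets_def A'_def)
    qed
  qed
  have "(k, True) \<notin># M" if "M \<in> ovp_msets A' n" for M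
    using that by (auto simp: ovp_msets_def A'_def)
  then have disj: "ovp_msets A' n \<inter> ?f ` ovp_msets A' (n - k) = {}"
    by fastforce
  have fin: "finite (ovp_msets A' j)" for j
    using A by (intro finite_ovp_msets) (auto simp: A'_def)
  have "card (?f ` ovp_msets A' (n - k)) = ovp_count A' (n - k)"
    unfolding ovp_count_def by (rule card_image) (auto simp: inj_on_def)
  then show ?thesis
    using disj fin by (auto simp: ovp_count_def eq card_Un_disjoint)
qed

text \<open>Further copies of the plain \<open>k\<close> may remain after one is removed, so
  \<open>A\<close> itself returns on the right-hand side; in generating functions this is the factor
  1 / (1 - q ^ k).\<close>

lemma ovp_count_remove_plain:
  assumes A: "A \<subseteq> positive_parts" and x: "(k, False) \<in> A"
  defines "A' \<equiv> A - {(k, False)}"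
  shows "ovp_count A n = ovp_count A' n + (if k \<le> n then ovp_count A (n - k) else 0)"
proof -
  let ?f = "add_mset (k, False)"
  have eq: "ovp_msets A n = ovp_msets A' n \<union> (if k \<le> n then ?f ` ovp_msets A (n - k) else {})"
  proof (intro equalityI subsetI)
    fix M assume M: "M \<in> ovp_msets A n"
    show "M \<in> ovp_msets A' n \<union> (if k \<le> n then ?f ` ovp_msets A (n - k) else {})"
    proof (cases "(k, False) \<in># M")
      case True
      then obtain N where N: "M = ?f N" by (metis insert_DiffM)
      then have "N \<in> ovp_msets A (n - k)" "k \<le> n"
        using M by (auto simp: ovp_msets_def)
      then show ?thesis using N by auto
    next
      case False
      then show ?thesis using M by (auto simp: ovp_msets_def A'_def)
    qed
  next
    fix M assume "M \<in> ovp_msets A' n \<union> (if k \<le> n then ?f ` ovp_msets A (n - k) else {})"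
    then show "M \<in> ovp_msets A n"
      using x by (auto simp: ovp_msets_def A'_def split: if_splits)
  qed
  have "(k, False) \<notin># M" if "M \<in> ovp_msets A' n" for M
    using that by (auto simp: ovp_msets_def A'_def)
  then have disj: "ovp_msets A' n \<inter> ?f ` ovp_msets A (n - k) = {}"
    by fastforce
  have fin: "finite (ovp_msets A' j)" "finite (ovp_msets A j)" for j
    using A by (auto intro!: finite_ovp_msets simp: A'_def)
  have "card (?f ` ovp_msets A (n - k)) = ovp_count A (n - k)"
    unfolding ovp_count_def by (rule card_image) (auto simp: inj_on_def)
  then show ?thesis
    using disj fin by (auto simp: ovp_count_def eq card_Un_disjoint)
qed

lemma ovp_count_empty: "ovp_count {} n = (if n = 0 then 1 else 0)"
proof -
  have "ovp_msets {} n = (if n = 0 then {{#}} else {})"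
    by (auto simp: ovp_msets_def)
  then show ?thesis by (simp add: ovp_count_def)
qed

lemma ovp_count_cong:
  assumes "A \<inter> {..n} \<times> UNIV = B \<inter> {..n} \<times> UNIV"
  shows "ovp_count A n = ovp_count B n"
proof -
  have "set_mset M \<subseteq> {..n} \<times> UNIV" if "sum_mset (image_mset fst M) = n" for M :: "(nat \<times> bool) multiset"
  proof
    fix x assume "x \<in># M"
    then obtain N where "M = add_mset x N" by (metis insert_DiffM)
    then show "x \<in> {..n} \<times> UNIV" using that by (auto simp: mem_Times_iff)
  qed
  then have "ovp_msets A n = ovp_msets B n"
    using assms unfolding ovp_msets_def by blast
  then show ?thesis by (simp add: ovp_count_def)
qed

section \<open>Overpartitions with 1, ..., m overlined, and the mex\<close>

definition overlined_from :: "nat \<Rightarrow> (nat \<times> bool) set" where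
  "overlined_from m = positive_parts - {1..m} \<times> {True}"

lemma overlined_from_subset: "overlined_from m \<subseteq> positive_parts"
  by (auto simp: overlined_from_def)

lemma overlined_from_0 [simp]: "overlined_from 0 = positive_parts"
  by (auto simp: overlined_from_def)

lemma ovp_count_overlined_from:
  "ovp_count (overlined_from m) n =
     ovp_count (overlined_from (Suc m)) n +
     (if Suc m \<le> n then ovp_count (overlined_from (Suc m)) (n - Suc m) else 0)"
proof -
  have "overlined_from m - {(Suc m, True)} = overlined_from (Suc m)"
    by (auto simp: overlined_from_def le_Suc_eq)
  moreover have "(Suc m, True) \<in> overlined_from m"
    by (auto simp: overlined_from_def positive_parts_def)
  ultimately show ?thesis
    using ovp_count_remove_overlined[OF overlined_from_subset, of "Suc m" m n] by simp
qed

text \<open>Adding a plain part 1 injects the overpartitions of \<open>n\<close> into those of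
  \<open>Suc n\<close>; no \<open>overlined_from m\<close> excludes plain parts.\<close>

lemma mono_ovp_count_overlined_from: "mono (ovp_count (overlined_from m))"
proof (rule incseq_SucI)
  fix n
  have "(1, False) \<in> overlined_from m"
    by (auto simp: overlined_from_def positive_parts_def)
  from ovp_count_remove_plain[OF overlined_from_subset this, of "Suc n"]
  show "ovp_count (overlined_from m) n \<le> ovp_count (overlined_from m) (Suc n)" by simp
qed

definition initial_overlined :: "nat \<Rightarrow> nat \<Rightarrow> (nat \<times> bool) multiset set" where
  "initial_overlined m n = {M \<in> ovp_msets positive_parts n. \<forall>j\<in>{1..m}. (j, True) \<in># M}"

text \<open>Subtracting the multiset \<open>L\<close> of the overlined parts 1, ..., m, each of
  which occurs exactly once, leaves an overpartition whose overlined parts exceed \<open>m\<close>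
  and whose weight has dropped by 1 + ... + m.\<close>

lemma card_initial_overlined:
  "card (initial_overlined m n) =
     (if \<Sum>{1..m} \<le> n then ovp_count (overlined_from m) (n - \<Sum>{1..m}) else 0)"
proof -
  define L :: "(nat \<times> bool) multiset" where "L = mset_set ({1..m} \<times> {True})"
  have count_L: "count L x = (if x \<in> {1..m} \<times> {True} then 1 else 0)" for x
    by (simp add: L_def)
  have sum_L: "sum_mset (image_mset fst L) = \<Sum>{1..m}"
  proof -
    have "sum_mset (image_mset fst L) = (\<Sum>x\<in>{1..m} \<times> {True}. fst x)"
      by (simp add: L_def sum_unfold_sum_mset)
    also have "\<dots> = \<Sum>{1..m}"
      by (rule sum.reindex_bij_witness[of _ "\<lambda>j. (j, True)" fst]) auto
    finally show ?thesis .
  qed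
  have L_sub: "L \<subseteq># M" if "M \<in> initial_overlined m n" for M
    using that by (auto simp: subseteq_mset_def count_L initial_overlined_def Suc_le_eq)
  have fwd: "M - L \<in> ovp_msets (overlined_from m) (n - \<Sum>{1..m}) \<and> \<Sum>{1..m} \<le> n"
    if M: "M \<in> initial_overlined m n" for M
  proof -
    obtain N where N: "M = L + N" using L_sub[OF M] by (metis mset_subset_eq_exists_conv)
    have cnt: "count L (j, True) + count N (j, True) \<le> 1" for j
      using M N by (auto simp: initial_overlined_def ovp_msets_def)
    have "count N (j, True) = 0" if "j \<in> {1..m}" for j
      using cnt[of j] that by (simp add: count_L)
    then have "(j, True) \<notin># N" if "j \<in> {1..m}" for j
      using that by (metis count_eq_zero_iff)
    moreover have "set_mset N \<subseteq> positive_parts" "sum_mset (image_mset fst N) + \<Sum>{1..m} = n"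
      using M N sum_L by (auto simp: initial_overlined_def ovp_msets_def)
    moreover have "count N (j, True) \<le> 1" for j using cnt[of j] by simp
    ultimately have "N \<in> ovp_msets (overlined_from m) (n - \<Sum>{1..m}) \<and> \<Sum>{1..m} \<le> n"
      by (auto simp: ovp_msets_def overlined_from_def)
    then show ?thesis by (simp add: N)
  qed
  show ?thesis
  proof (cases "\<Sum>{1..m} \<le> n")
    case True
    have "bij_betw (\<lambda>M. M - L) (initial_overlined m n) (ovp_msets (overlined_from m) (n - \<Sum>{1..m}))"
    proof (rule bij_betw_byWitness[where f' = "\<lambda>N. N + L"])
      show "(\<lambda>N. N + L) ` ovp_msets (overlined_from m) (n - \<Sum>{1..m}) \<subseteq> initial_overlined m n"
      proof safe
        fix N assume N: "N \<in> ovp_msets (overlined_from m) (n - \<Sum>{1..m})"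
        have z: "count N (j, True) = 0" if "j \<in> {1..m}" for j
          using N that by (auto simp: ovp_msets_def overlined_from_def count_eq_zero_iff)
        have "count (N + L) (j, True) \<le> 1" for j
          using N z[of j] by (auto simp: ovp_msets_def count_L)
        moreover have "set_mset (N + L) \<subseteq> positive_parts"
          using N by (auto simp: ovp_msets_def overlined_from_def L_def positive_parts_def)
        ultimately show "N + L \<in> initial_overlined m n"
          using N True sum_L by (auto simp: initial_overlined_def ovp_msets_def L_def)
      qed
    qed (use L_sub fwd in auto)
    then show ?thesis using True by (simp add: ovp_count_def bij_betw_same_card)
  next
    case False
    then have "initial_overlined m n = {}" using fwd by blast
    then show ?thesis using False by (simp add: card_eq_0_iff)
  qed
qed

text \<open>The mex counts the numbers m below it, that is, those for which 1, ..., m are all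
  overlined; m = 0 qualifies vacuously, and no m > n does since parts are at most
  \<open>n\<close>.\<close>

lemma overlined_mex_eq_sum:
  assumes p: "overpartition n p"
  shows "overlined_mex p = (\<Sum>m\<le>n. if \<forall>j\<in>{1..m}. (j, True) \<in> set p then 1 else 0)"
proof -
  let ?Q = "\<lambda>m. m > 0 \<and> (m, True) \<notin> set p"
  have le: "k \<le> n" if "(k, b) \<in> set p" for k b
  proof -
    have "k \<in> set (map fst p)" using that by force
    then show ?thesis using p member_le_sum_list[of k "map fst p"] by (auto simp: overpartition_def)
  qed
  have ex: "?Q (Suc n)" using le by force
  define e where "e = overlined_mex p"
  have Qe: "?Q e" and least: "\<And>m. ?Q m \<Longrightarrow> e \<le> m"
    unfolding e_def overlined_mex_def using LeastI[of ?Q, OF ex] Least_le[of ?Q] by blast+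
  have "{m. m \<le> n \<and> (\<forall>j\<in>{1..m}. (j, True) \<in> set p)} = {..<e}"
  proof (intro equalityI subsetI)
    fix m assume "m \<in> {m. m \<le> n \<and> (\<forall>j\<in>{1..m}. (j, True) \<in> set p)}"
    then show "m \<in> {..<e}" using Qe by force
  next
    fix m assume m: "m \<in> {..<e}"
    have "(j, True) \<in> set p" if "j \<in> {1..m}" for j
      using least[of j] m that by auto
    moreover have "m \<le> n" using least[OF ex] m by auto
    ultimately show "m \<in> {m. m \<le> n \<and> (\<forall>j\<in>{1..m}. (j, True) \<in> set p)}" by auto
  qed
  then have "e = card {m. m \<le> n \<and> (\<forall>j\<in>{1..m}. (j, True) \<in> set p)}" by simp
  also have "{m. m \<le> n \<and> (\<forall>j\<in>{1..m}. (j, True) \<in> set p)} = {m \<in> {..n}. \<forall>j\<in>{1..m}. (j, True) \<in> set p}"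
    by auto
  also have "card \<dots> = (\<Sum>m\<le>n. if \<forall>j\<in>{1..m}. (j, True) \<in> set p then 1 else 0)"
    by (subst sum.inter_filter[symmetric]) auto
  finally show ?thesis by (simp add: e_def)
qed

lemma sigma_overlined_mex_eq: "sigma_overlined_mex n = (\<Sum>m\<le>n. card (initial_overlined m n))"
proof -
  let ?b = "\<lambda>m M. if \<forall>j\<in>{1..m}. (j, True) \<in># M then 1 else (0::nat)"
  have "sigma_overlined_mex n = (\<Sum>p | overpartition n p. \<Sum>m\<le>n. ?b m (mset p))"
    unfolding sigma_overlined_mex_def using overlined_mex_eq_sum by (intro sum.cong) auto
  also have "\<dots> = (\<Sum>M\<in>ovp_msets positive_parts n. \<Sum>m\<le>n. ?b m M)"
    by (rule sum.reindex_bij_betw[OF bij_betw_mset_overpartitions])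
  also have "\<dots> = (\<Sum>m\<le>n. \<Sum>M\<in>ovp_msets positive_parts n. ?b m M)"
    by (rule sum.swap)
  also have "\<dots> = (\<Sum>m\<le>n. card (initial_overlined m n))"
    unfolding initial_overlined_def
    by (intro sum.cong refl, subst sum.inter_filter[symmetric])
       (auto intro!: finite_ovp_msets)
  finally show ?thesis .
qed

text \<open>The recurrence writes the right-hand side as two counts for \<open>Suc m\<close>, at n +
  m + 1 and at n; monotonicity lowers the first to the second. The companion bound below raises the
  smaller count instead, and together they squeeze the quotient of the counts for
  \<open>Suc m\<close> and \<open>m\<close> to 1 / 2.\<close>

lemma twice_ovp_count_overlined_from_le:
  "2 * ovp_count (overlined_from (Suc m)) n \<le> ovp_count (overlined_from m) (n + Suc m)"
proof -
  have "ovp_count (overlined_from (Suc m)) n \<le> ovp_count (overlined_from (Suc m)) (n + Suc m)"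
    by (rule monoD[OF mono_ovp_count_overlined_from]) simp
  then show ?thesis
    by (subst ovp_count_overlined_from) simp
qed

lemma ovp_count_overlined_from_le:
  "ovp_count (overlined_from m) n \<le> 2 * ovp_count (overlined_from (Suc m)) n"
proof -
  have "ovp_count (overlined_from (Suc m)) (n - Suc m) \<le> ovp_count (overlined_from (Suc m)) n"
    by (rule monoD[OF mono_ovp_count_overlined_from]) simp
  then show ?thesis
    by (subst ovp_count_overlined_from) simp
qed

lemma card_initial_overlined_le:
  "2 ^ m * card (initial_overlined m n) \<le> ovp_count positive_parts n"
proof (induction m)
  case 0
  then show ?case by (simp add: card_initial_overlined)
next
  case (Suc m)
  have "2 * card (initial_overlined (Suc m) n) \<le> card (initial_overlined m n)"
  proof (cases "\<Sum>{1..Suc m} \<le> n")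
    case True
    \<comment> \<open>Triangular numbers make the weights match: removing 1, ..., m + 1 and
      returning m + 1 amounts to removing 1, ..., m.\<close>
    then have "n - \<Sum>{1..Suc m} + Suc m = n - \<Sum>{1..m}" by simp
    then show ?thesis
      using True twice_ovp_count_overlined_from_le[of m "n - \<Sum>{1..Suc m}"]
      by (simp add: card_initial_overlined)
  qed (simp add: card_initial_overlined)
  then have "2 ^ m * (2 * card (initial_overlined (Suc m) n)) \<le> 2 ^ m * card (initial_overlined m n)"
    by (intro mult_left_mono) auto
  also have "\<dots> \<le> ovp_count positive_parts n" by (rule Suc)
  finally show ?case by (simp add: mult_ac)
qed

section \<open>The generating function\<close>

text \<open>Dominated convergence for series along an arbitrary filter; the same form serves limits
  in \<open>n\<close>, in a truncation \<open>N\<close>, and as t tends to 0 from the right.\<close>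

lemma tannery_all:
  fixes a :: "nat \<Rightarrow> 'b \<Rightarrow> 'a :: {real_normed_algebra, banach}"
  assumes "\<And>k. (a k \<longlongrightarrow> b k) F" and "\<forall>\<^sub>F n in F. \<forall>k. norm (a k n) \<le> M k"
    and "summable M" and "F \<noteq> bot"
  shows "((\<lambda>n. \<Sum>k. a k n) \<longlongrightarrow> (\<Sum>k. b k)) F"
proof -
  have "\<forall>\<^sub>F (k, n) in at_top \<times>\<^sub>F F. norm (a k n) \<le> M k"
    unfolding eventually_prod_filter using assms(2)
    by (intro exI[of _ "\<lambda>_. True"] exI[of _ "\<lambda>n. \<forall>k. norm (a k n) \<le> M k"]) auto
  from tannerys_theorem[OF assms(1) this assms(3,4)] show ?thesis by blast
qed

lemma sums_power_shift:
  fixes q :: "'a :: {real_normed_field, banach}"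
  assumes "(\<lambda>n. c n * q ^ n) sums C"
  shows "(\<lambda>n. (if k \<le> n then c (n - k) else 0) * q ^ n) sums (q ^ k * C)"
proof -
  let ?f = "\<lambda>n. (if k \<le> n then c (n - k) else 0) * q ^ n"
  have "(\<lambda>n. ?f (n + k)) sums (q ^ k * C)"
    using sums_mult[OF assms, of "q ^ k"] by (simp add: power_add mult_ac)
  moreover have "(\<Sum>i<k. ?f i) = 0" by (rule sum.neutral) auto
  ultimately show ?thesis using sums_iff_shift[of ?f k "q ^ k * C"] by simp
qed

text \<open>In the plain case the recurrence has the same series on both sides and can be solved
  only once convergence is known. Partial sums avoid the circle: they satisfy S \<le> B + r ^ k * S,
  hence S \<le> B / (1 - r ^ k).\<close>

lemma summable_ovp_count_finite:
  fixes r :: real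
  assumes r: "0 \<le> r" "r < 1" and A: "finite A" "A \<subseteq> positive_parts"
  shows "summable (\<lambda>n. real (ovp_count A n) * r ^ n)"
  using A
proof (induction A)
  case empty
  have "(\<lambda>n. real (ovp_count {} n) * r ^ n) = (\<lambda>n. if n = 0 then 1 else 0)"
    by (auto simp: ovp_count_empty)
  then show ?case using summable_single[of 0 "\<lambda>_. 1"] by (simp del: summable_single)
next
  case (insert x A)
  then have IH: "summable (\<lambda>n. real (ovp_count A n) * r ^ n)" by auto
  obtain k b where x: "x = (k, b)" by force
  have k: "k > 0" using insert.prems x by (auto simp: positive_parts_def)
  show ?case
  proof (cases b)
    case True
    have *: "ovp_count (insert x A) n = ovp_count A n + (if k \<le> n then ovp_count A (n - k) else 0)" for n
      using ovp_count_remove_overlined[of "insert x A" k n] insert.prems insert.hyps x True by simp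
    have "summable (\<lambda>n. real (ovp_count A n) * r ^ n +
        (if k \<le> n then real (ovp_count A (n - k)) else 0) * r ^ n)"
      using sums_power_shift[OF summable_sums[OF IH], of k]
      by (intro summable_add IH) (auto simp: sums_iff)
    then show ?thesis by (rule summable_cong[THEN iffD1, rotated]) (auto simp: * algebra_simps)
  next
    case False
    let ?a = "\<lambda>n. real (ovp_count (insert x A) n) * r ^ n"
    have *: "ovp_count (insert x A) n =
        ovp_count A n + (if k \<le> n then ovp_count (insert x A) (n - k) else 0)" for n
      using ovp_count_remove_plain[of "insert x A" k n] insert.prems insert.hyps x False by simp
    have rk: "r ^ k < 1" using r k by (simp add: power_less_one_iff)
    define B where "B = (\<Sum>n. real (ovp_count A n) * r ^ n)"
    show ?thesis
    proof (rule summableI_nonneg_bounded)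
      show "0 \<le> ?a n" for n using r by simp
      fix M
      have "(\<Sum>n<M. ?a n) = (\<Sum>n<M. real (ovp_count A n) * r ^ n) +
          (\<Sum>n<M. if k \<le> n then ?a (n - k) * r ^ k else 0)"
        unfolding sum.distrib[symmetric]
      proof (rule sum.cong, simp)
        fix n
        show "?a n = real (ovp_count A n) * r ^ n + (if k \<le> n then ?a (n - k) * r ^ k else 0)"
          by (subst *) (auto simp: algebra_simps simp flip: power_add)
      qed
      also have "(\<Sum>n<M. if k \<le> n then ?a (n - k) * r ^ k else 0) = (\<Sum>n\<in>{k..<M}. ?a (n - k) * r ^ k)"
        by (rule sum.mono_neutral_cong_right) auto
      also have "\<dots> = (\<Sum>n<M-k. ?a n * r ^ k)"
        by (rule sum.reindex_bij_witness[of _ "\<lambda>n. n + k" "\<lambda>n. n - k"]) auto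
      also have "\<dots> \<le> (\<Sum>n<M. ?a n * r ^ k)"
        using r by (intro sum_mono2) auto
      also have "\<dots> = r ^ k * (\<Sum>n<M. ?a n)" by (simp add: sum_distrib_left mult_ac)
      also have "(\<Sum>n<M. real (ovp_count A n) * r ^ n) \<le> B"
        unfolding B_def using r by (intro sum_le_suminf IH) auto
      finally have "(1 - r ^ k) * (\<Sum>n<M. ?a n) \<le> B" by (simp add: algebra_simps)
      then show "(\<Sum>n<M. ?a n) \<le> B / (1 - r ^ k)"
        using rk by (simp add: field_simps)
    qed
  qed
qed

lemma ovp_count_finite_sums:
  fixes q :: complex
  assumes q: "norm q < 1" and A: "finite A" "A \<subseteq> positive_parts"
  shows "(\<lambda>n. of_nat (ovp_count A n) * q ^ n) sums
    (\<Prod>x\<in>A. if snd x then 1 + q ^ fst x else 1 / (1 - q ^ fst x))"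
proof -
  have summ: "summable (\<lambda>n. of_nat (ovp_count A n) * q ^ n)" if "finite A" "A \<subseteq> positive_parts" for A
    using summable_ovp_count_finite[of "norm q" A] that q
    by (intro summable_norm_cancel[of "\<lambda>n. of_nat (ovp_count A n) * q ^ n"])
       (simp add: norm_mult norm_power)
  define S where "S A = (\<Sum>n. of_nat (ovp_count A n) * q ^ n)" for A
  have S: "(\<lambda>n. of_nat (ovp_count A n) * q ^ n) sums S A" if "finite A" "A \<subseteq> positive_parts" for A
    unfolding S_def using summ[OF that] by (rule summable_sums)
  have "S A = (\<Prod>x\<in>A. if snd x then 1 + q ^ fst x else 1 / (1 - q ^ fst x))"
    using A
  proof (induction A)
    case empty
    have "(\<lambda>n. of_nat (ovp_count {} n) * q ^ n) = (\<lambda>n. if n = 0 then 1 else 0)"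
      by (auto simp: ovp_count_empty)
    then have "S {} = 1" unfolding S_def using sums_single[of 0 "\<lambda>_. 1::complex"]
      by (simp add: sums_iff)
    then show ?case by simp
  next
    case (insert x A)
    obtain k b where x: "x = (k, b)" by force
    have k: "k > 0" using insert.prems x by (auto simp: positive_parts_def)
    have fA: "finite A" "A \<subseteq> positive_parts" and fI: "finite (insert x A)" "insert x A \<subseteq> positive_parts"
      using insert by auto
    have "S (insert x A) = (if b then 1 + q ^ k else 1 / (1 - q ^ k)) * S A"
    proof (cases b)
      case True
      have *: "ovp_count (insert x A) n = ovp_count A n + (if k \<le> n then ovp_count A (n - k) else 0)" for n
        using ovp_count_remove_overlined[of "insert x A" k n] insert.prems insert.hyps x True by simp
      have "(\<lambda>n. of_nat (ovp_count A n) * q ^ n +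
          (if k \<le> n then of_nat (ovp_count A (n - k)) else 0) * q ^ n) sums (S A + q ^ k * S A)"
        by (intro sums_add S fA sums_power_shift)
      also have "(\<lambda>n. of_nat (ovp_count A n) * q ^ n +
          (if k \<le> n then of_nat (ovp_count A (n - k)) else 0) * q ^ n) =
          (\<lambda>n. of_nat (ovp_count (insert x A) n) * q ^ n)"
        by (auto simp: * algebra_simps)
      finally have "S (insert x A) = S A + q ^ k * S A"
        unfolding S_def by (rule sums_unique[symmetric])
      then show ?thesis using True by (simp add: algebra_simps)
    next
      case False
      have *: "ovp_count (insert x A) n =
          ovp_count A n + (if k \<le> n then ovp_count (insert x A) (n - k) else 0)" for n
        using ovp_count_remove_plain[of "insert x A" k n] insert.prems insert.hyps x False by simp
      have "(\<lambda>n. of_nat (ovp_count A n) * q ^ n +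
          (if k \<le> n then of_nat (ovp_count (insert x A) (n - k)) else 0) * q ^ n) sums
          (S A + q ^ k * S (insert x A))"
        by (intro sums_add S fA fI sums_power_shift)
      also have "(\<lambda>n. of_nat (ovp_count A n) * q ^ n +
          (if k \<le> n then of_nat (ovp_count (insert x A) (n - k)) else 0) * q ^ n) =
          (\<lambda>n. of_nat (ovp_count (insert x A) n) * q ^ n)"
      proof
        fix n
        show "of_nat (ovp_count A n) * q ^ n +
          (if k \<le> n then of_nat (ovp_count (insert x A) (n - k)) else 0) * q ^ n =
          of_nat (ovp_count (insert x A) n) * q ^ n"
          by (subst (2) *) (auto simp: algebra_simps)
      qed
      finally have "S (insert x A) = S A + q ^ k * S (insert x A)"
        unfolding S_def by (rule sums_unique[symmetric])
      moreover have "1 - q ^ k \<noteq> 0"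
      proof -
        have "norm (q ^ k) < 1" using q k by (simp add: norm_power power_less_one_iff)
        then show ?thesis by auto
      qed
      ultimately show ?thesis using False by (simp add: field_simps)
    qed
    then show ?case using insert fA by (simp add: x)
  qed
  then show ?thesis using S[OF A] by simp
qed

section \<open>The logarithm of the generating function as a Lambert series\<close>

lemma ln_ratio_sums:
  fixes z :: complex
  assumes z: "norm z < 1"
  shows "(\<lambda>j. 2 / of_nat (2 * j + 1) * z ^ (2 * j + 1)) sums (ln (1 + z) - ln (1 - z))"
proof -
  have "(\<lambda>n. - ((- z) ^ n) / of_nat n - - ((- (- z)) ^ n) / of_nat n) sums (ln (1 + z) - ln (1 + - z))"
    using z by (intro sums_diff Ln_series') auto
  then have "(\<lambda>n. (z ^ n - (- z) ^ n) / of_nat n) sums (ln (1 + z) - ln (1 - z))"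
    by (simp add: diff_divide_distrib)
  moreover have "strict_mono (\<lambda>j::nat. 2 * j + 1)" by (auto simp: strict_mono_def)
  moreover have "(z ^ n - (- z) ^ n) / of_nat n = 0" if "n \<notin> range (\<lambda>j::nat. 2 * j + 1)" for n
  proof -
    have "even n"
    proof (rule ccontr)
      assume "odd n"
      then obtain k where "n = 2 * k + 1" by (rule oddE)
      then show False using that by blast
    qed
    then show ?thesis by simp
  qed
  ultimately have "(\<lambda>j. (z ^ (2 * j + 1) - (- z) ^ (2 * j + 1)) / of_nat (2 * j + 1)) sums (ln (1 + z) - ln (1 - z))"
    using sums_mono_reindex[of "\<lambda>j::nat. 2 * j + 1" "\<lambda>n. (z ^ n - (- z) ^ n) / of_nat n"] by blast
  then show ?thesis by simp
qed

text \<open>Defining the logarithm as a series, not through the values of the generating function,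
  avoids any choice of branch on the disc; the polymorphic type covers real and complex arguments
  alike.\<close>

definition ovp_log :: "'a :: {real_normed_field, banach} \<Rightarrow> 'a" where
  "ovp_log q = (\<Sum>j. 2 / of_nat (2 * j + 1) * (q ^ (2 * j + 1) / (1 - q ^ (2 * j + 1))))"

lemma norm_geometric_le:
  fixes q :: "'a :: {real_normed_field, banach}"
  assumes q: "norm q < 1" and m: "m > 0"
  shows "norm (q ^ m / (1 - q ^ m)) \<le> norm q ^ m / (1 - norm q)"
proof -
  have "norm q ^ m \<le> norm q ^ 1" using q m by (intro power_decreasing) auto
  moreover have "1 - norm q ^ m \<le> norm (1 - q ^ m)"
    using norm_triangle_ineq2[of 1 "q ^ m"] by (simp add: norm_power)
  ultimately have "1 - norm q \<le> norm (1 - q ^ m)" by simp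
  then show ?thesis
    using q by (auto simp: norm_divide norm_power intro!: divide_left_mono mult_pos_pos)
qed

lemma summable_odd_powers:
  assumes "0 \<le> (r::real)" "r < 1"
  shows "summable (\<lambda>j::nat. c * r ^ (2 * j + 1))"
proof -
  have "summable (\<lambda>j. (c * r) * (r ^ 2) ^ j)"
    using assms by (intro summable_mult summable_geometric) (simp add: power_less_one_iff abs_square_less_1)
  also have "(\<lambda>j. (c * r) * (r ^ 2) ^ j) = (\<lambda>j::nat. c * r ^ (2 * j + 1))"
    by (auto simp flip: power_mult)
  finally show ?thesis .
qed

lemma two_div_odd_le: "norm (2 / of_nat (2 * j + 1) :: 'a :: {real_normed_field}) \<le> 2"
proof -
  have "norm (2 / of_nat (2 * j + 1) :: 'a) = 2 / real (2 * j + 1)"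
    by (simp only: norm_divide norm_of_nat norm_numeral)
  also have "\<dots> \<le> 2" by (simp add: field_simps)
  finally show ?thesis .
qed

lemma summable_ovp_log:
  fixes q :: "'a :: {real_normed_field, banach}"
  assumes q: "norm q < 1"
  shows "summable (\<lambda>j. 2 / of_nat (2 * j + 1) * (q ^ (2 * j + 1) / (1 - q ^ (2 * j + 1))))"
proof (rule summable_comparison_test')
  show "summable (\<lambda>j. 2 / (1 - norm q) * norm q ^ (2 * j + 1))"
    using q by (intro summable_odd_powers) auto
  fix j
  have "norm (2 / of_nat (2 * j + 1) * (q ^ (2 * j + 1) / (1 - q ^ (2 * j + 1)))) \<le>
      2 * (norm q ^ (2 * j + 1) / (1 - norm q))"
    unfolding norm_mult[of "2 / of_nat (2 * j + 1)"]
    by (intro mult_mono two_div_odd_le norm_geometric_le q) auto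
  then show "norm (2 / of_nat (2 * j + 1) * (q ^ (2 * j + 1) / (1 - q ^ (2 * j + 1)))) \<le>
      2 / (1 - norm q) * norm q ^ (2 * j + 1)"
    by simp
qed

text \<open>Interchange of the sums over n and over odd k in the double series of q ^ (n * k). A
  partial sum over n is still a series in k, whose terms are dominated independently of
  \<open>N\<close> by a geometric sum, so Tannery's theorem applies.\<close>

lemma ovp_log_sums:
  fixes q :: complex
  assumes q: "norm q < 1"
  shows "(\<lambda>n. ln (1 + q ^ Suc n) - ln (1 - q ^ Suc n)) sums ovp_log q"
proof -
  let ?c = "\<lambda>j. 2 / of_nat (2 * j + 1) :: complex" and ?m = "\<lambda>j::nat. 2 * j + 1"
  let ?a = "\<lambda>j N. ?c j * (\<Sum>n<N. (q ^ Suc n) ^ ?m j)"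
  have qn: "norm (q ^ Suc n) < 1" for n
    using q by (simp add: norm_power power_less_one_iff del: power_Suc)
  have fin: "(\<Sum>n<N. ln (1 + q ^ Suc n) - ln (1 - q ^ Suc n)) = (\<Sum>j. ?a j N)" for N
  proof -
    have "(\<lambda>j. \<Sum>n<N. ?c j * (q ^ Suc n) ^ ?m j) sums (\<Sum>n<N. ln (1 + q ^ Suc n) - ln (1 - q ^ Suc n))"
      by (intro sums_sum ln_ratio_sums qn)
    then show ?thesis by (simp add: sums_iff sum_distrib_left)
  qed
  have geo: "(\<lambda>n. (q ^ Suc n) ^ m) sums (q ^ m / (1 - q ^ m))" if "m > 0" for m
  proof -
    have "norm (q ^ m) < 1" using q that by (simp add: norm_power power_less_one_iff)
    from sums_mult[OF geometric_sums[OF this], of "q ^ m"] show ?thesis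
      by (simp add: power_mult_distrib power_commutes flip: power_mult) (simp add: mult_ac)
  qed
  have geo_r: "(\<Sum>n<N. norm ((q ^ Suc n) ^ m)) \<le> norm q ^ m / (1 - norm q)" if "m > 0" for m N
  proof -
    have "(\<Sum>n<N. norm ((q ^ Suc n) ^ m)) = norm q ^ m * (\<Sum>n<N. (norm q ^ m) ^ n)"
      by (simp add: norm_power norm_mult sum_distrib_left power_mult_distrib power_mult flip: power_mult)
         (simp add: mult_ac)
    also have "\<dots> \<le> norm q ^ m * (\<Sum>n<N. norm q ^ n)"
    proof (intro mult_left_mono sum_mono)
      fix n
      show "(norm q ^ m) ^ n \<le> norm q ^ n"
        using q that by (simp add: power_mult[symmetric]) (intro power_decreasing; simp)
    qed auto
    also have "\<dots> \<le> norm q ^ m * (\<Sum>n. norm q ^ n)"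
      using q by (intro mult_left_mono sum_le_suminf summable_geometric) auto
    also have "\<dots> = norm q ^ m / (1 - norm q)" using q by (simp add: suminf_geometric)
    finally show ?thesis .
  qed
  have "(\<lambda>N. \<Sum>j. ?a j N) \<longlonglongrightarrow> (\<Sum>j. ?c j * (q ^ ?m j / (1 - q ^ ?m j)))"
  proof (rule tannery_all)
    show "?a j \<longlonglongrightarrow> ?c j * (q ^ ?m j / (1 - q ^ ?m j))" for j
      using geo[of "?m j"] by (intro tendsto_mult_left) (simp add: sums_def)
    show "summable (\<lambda>j. 2 / (1 - norm q) * norm q ^ ?m j)"
      using q by (intro summable_odd_powers) auto
    show "\<forall>\<^sub>F N in sequentially. \<forall>j. norm (?a j N) \<le> 2 / (1 - norm q) * norm q ^ ?m j"
    proof (intro always_eventually allI)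
      fix N j
      have "norm (?a j N) \<le> 2 * (norm q ^ ?m j / (1 - norm q))"
        unfolding norm_mult
        by (intro mult_mono two_div_odd_le order.trans[OF norm_sum geo_r]) auto
      then show "norm (?a j N) \<le> 2 / (1 - norm q) * norm q ^ ?m j" by simp
    qed
  qed simp
  then show ?thesis unfolding sums_def ovp_log_def fin .
qed

lemma of_real_ovp_log:
  assumes "\<bar>r\<bar> < 1"
  shows "ovp_log (of_real r :: complex) = of_real (ovp_log r)"
proof -
  have "summable (\<lambda>j. 2 / of_nat (2 * j + 1) * (r ^ (2 * j + 1) / (1 - r ^ (2 * j + 1))))"
    using assms by (intro summable_ovp_log) auto
  from suminf_of_real[OF this, where 'a = complex] show ?thesis
    unfolding ovp_log_def by simp
qed

lemma ovp_count_parts_le_sums: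
  fixes q :: complex
  assumes q: "norm q < 1"
  shows "(\<lambda>n. of_nat (ovp_count ({1..N} \<times> UNIV) n) * q ^ n) sums
    exp (\<Sum>n<N. ln (1 + q ^ Suc n) - ln (1 - q ^ Suc n))"
proof -
  have "(\<Prod>x\<in>{1..N} \<times> UNIV. if snd x then 1 + q ^ fst x else 1 / (1 - q ^ fst x)) =
      (\<Prod>k\<in>{1..N}. \<Prod>b\<in>UNIV. if b then 1 + q ^ k else 1 / (1 - q ^ k))"
    by (subst prod.cartesian_product) (auto simp: case_prod_beta intro!: prod.cong)
  also have "\<dots> = (\<Prod>k\<in>{1..N}. (1 + q ^ k) / (1 - q ^ k))"
    by (simp add: UNIV_bool)
  also have "\<dots> = (\<Prod>n<N. (1 + q ^ Suc n) / (1 - q ^ Suc n))"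
    by (rule prod.reindex_bij_witness[of _ Suc "\<lambda>n. n - 1"]) auto
  also have "\<dots> = (\<Prod>n<N. exp (ln (1 + q ^ Suc n) - ln (1 - q ^ Suc n)))"
  proof (rule prod.cong[OF refl])
    fix n
    have *: "norm (q ^ Suc n) < 1"
      using q by (simp add: norm_power power_less_one_iff del: power_Suc)
    have "1 + q ^ Suc n \<noteq> 0"
    proof
      assume "1 + q ^ Suc n = 0"
      then have "q ^ Suc n = - 1" by (metis add_eq_0_iff)
      then show False using * by (simp del: power_Suc)
    qed
    moreover have "1 - q ^ Suc n \<noteq> 0" using * by auto
    ultimately show "(1 + q ^ Suc n) / (1 - q ^ Suc n) = exp (ln (1 + q ^ Suc n) - ln (1 - q ^ Suc n))"
      by (simp add: exp_diff del: power_Suc)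
  qed
  also have "\<dots> = exp (\<Sum>n<N. ln (1 + q ^ Suc n) - ln (1 - q ^ Suc n))"
    by (simp add: exp_sum)
  finally have prod: "(\<Prod>x\<in>{1..N} \<times> UNIV. if snd x then 1 + q ^ fst x else 1 / (1 - q ^ fst x)) =
      exp (\<Sum>n<N. ln (1 + q ^ Suc n) - ln (1 - q ^ Suc n))" .
  have "finite ({1..N} \<times> (UNIV :: bool set))" "{1..N} \<times> UNIV \<subseteq> positive_parts"
    by (auto simp: positive_parts_def)
  from ovp_count_finite_sums[OF q this] show ?thesis unfolding prod .
qed

lemma ovp_count_parts_le_eq:
  assumes "n \<le> N"
  shows "ovp_count ({1..N} \<times> UNIV) n = ovp_count positive_parts n"
  using assms by (intro ovp_count_cong) (auto simp: positive_parts_def)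

lemma ovp_count_parts_le_le: "ovp_count ({1..N} \<times> UNIV) n \<le> ovp_count positive_parts n"
  unfolding ovp_count_def
  by (intro card_mono finite_ovp_msets) (auto simp: ovp_msets_def positive_parts_def)

lemma ovp_log_real_sums:
  fixes r :: real
  assumes r: "0 \<le> r" "r < 1"
  shows "(\<Sum>n<N. ln (1 + r ^ Suc n) - ln (1 - r ^ Suc n)) \<le> ovp_log r"
    and "(\<lambda>n. ln (1 + r ^ Suc n) - ln (1 - r ^ Suc n)) sums ovp_log r"
proof -
  have rn: "0 \<le> r ^ Suc n" "r ^ Suc n < 1" for n
    using r by (simp_all add: power_less_one_iff del: power_Suc)
  have eq: "ln (1 + complex_of_real r ^ Suc n) - ln (1 - complex_of_real r ^ Suc n) =
      of_real (ln (1 + r ^ Suc n) - ln (1 - r ^ Suc n))" for n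
    using rn[of n] by (simp add: Ln_of_real[symmetric] del: power_Suc Ln_of_real flip: of_real_power)
  show *: "(\<lambda>n. ln (1 + r ^ Suc n) - ln (1 - r ^ Suc n)) sums ovp_log r"
    using ovp_log_sums[of "of_real r"] r unfolding eq
    by (simp only: of_real_ovp_log sums_of_real_iff norm_of_real abs_of_nonneg)
  have "ln (1 + r ^ Suc n) - ln (1 - r ^ Suc n) \<ge> 0" for n
    using rn[of n] by (simp del: power_Suc)
  with * show "(\<Sum>n<N. ln (1 + r ^ Suc n) - ln (1 - r ^ Suc n)) \<le> ovp_log r"
    using sum_le_suminf[of "\<lambda>n. ln (1 + r ^ Suc n) - ln (1 - r ^ Suc n)" "{..<N}"]
    by (simp add: sums_iff del: power_Suc)
qed

text \<open>The first \<open>M\<close> coefficients involve only parts up to \<open>M\<close>, so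
  the partial sum is bounded by the finite product over these parts; the logarithm of that product
  is a partial sum of a series with nonnegative terms and sum \<open>ovp_log r\<close>.\<close>

lemma summable_ovp_count:
  fixes r :: real
  assumes r: "0 \<le> r" "r < 1"
  shows "summable (\<lambda>n. real (ovp_count positive_parts n) * r ^ n)"
proof (rule summableI_nonneg_bounded)
  show "0 \<le> real (ovp_count positive_parts n) * r ^ n" for n using r by simp
  fix M
  have rn: "0 \<le> r ^ Suc n" "r ^ Suc n < 1" for n
    using r by (simp_all add: power_less_one_iff del: power_Suc)
  have eq: "ln (1 + complex_of_real r ^ Suc n) - ln (1 - complex_of_real r ^ Suc n) =
      of_real (ln (1 + r ^ Suc n) - ln (1 - r ^ Suc n))" for n
    using rn[of n] by (simp add: Ln_of_real[symmetric] del: power_Suc Ln_of_real flip: of_real_power)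
  let ?e = "exp (\<Sum>n<M. ln (1 + r ^ Suc n) - ln (1 - r ^ Suc n))"
  have "(\<lambda>n. of_nat (ovp_count ({1..M} \<times> UNIV) n) * complex_of_real r ^ n) sums complex_of_real ?e"
    using ovp_count_parts_le_sums[of "of_real r" M] r unfolding eq
    by (simp only: of_real_sum[symmetric] exp_of_real) simp
  then have s: "(\<lambda>n. real (ovp_count ({1..M} \<times> UNIV) n) * r ^ n) sums ?e"
    by (subst sums_of_real_iff[where 'a = complex, symmetric]) simp
  have "(\<Sum>n<M. real (ovp_count positive_parts n) * r ^ n) =
      (\<Sum>n<M. real (ovp_count ({1..M} \<times> UNIV) n) * r ^ n)"
    by (intro sum.cong) (auto simp: ovp_count_parts_le_eq simp del: One_nat_def)
  also have "\<dots> \<le> ?e"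
    using s sum_le_suminf[of "\<lambda>n. real (ovp_count ({1..M} \<times> UNIV) n) * r ^ n" "{..<M}"] r
    by (simp add: sums_iff)
  also have "\<dots> \<le> exp (ovp_log r)" using ovp_log_real_sums[OF r] by simp
  finally show "(\<Sum>n<M. real (ovp_count positive_parts n) * r ^ n) \<le> exp (ovp_log r)" .
qed

text \<open>Passage from parts up to \<open>N\<close> to all parts: each coefficient is eventually
  constant in \<open>N\<close> and never exceeds its final value, so the full series at the radius
  \<open>norm q\<close> is a majorant.\<close>

theorem ovp_count_sums:
  fixes q :: complex
  assumes q: "norm q < 1"
  shows "(\<lambda>n. of_nat (ovp_count positive_parts n) * q ^ n) sums exp (ovp_log q)"
proof -
  let ?a = "\<lambda>n N. of_nat (ovp_count ({1..N} \<times> UNIV) n) * q ^ n"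
  let ?M = "\<lambda>n. real (ovp_count positive_parts n) * norm q ^ n"
  have M: "summable ?M" using q by (intro summable_ovp_count) auto
  have "(\<lambda>N. \<Sum>n. ?a n N) \<longlonglongrightarrow> (\<Sum>n. of_nat (ovp_count positive_parts n) * q ^ n)"
  proof (rule tannery_all[OF _ _ M])
    show "?a n \<longlonglongrightarrow> of_nat (ovp_count positive_parts n) * q ^ n" for n
      by (rule tendsto_eventually) (auto simp: eventually_sequentially ovp_count_parts_le_eq simp del: One_nat_def intro!: exI[of _ n])
    show "\<forall>\<^sub>F N in sequentially. \<forall>n. norm (?a n N) \<le> ?M n"
      using ovp_count_parts_le_le
      by (intro always_eventually) (auto simp: norm_mult norm_power intro!: mult_right_mono)
  qed simp
  moreover have "(\<Sum>n. ?a n N) = exp (\<Sum>n<N. ln (1 + q ^ Suc n) - ln (1 - q ^ Suc n))" for N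
    using ovp_count_parts_le_sums[OF q, of N] by (simp add: sums_iff)
  ultimately have "(\<lambda>N. exp (\<Sum>n<N. ln (1 + q ^ Suc n) - ln (1 - q ^ Suc n))) \<longlonglongrightarrow>
      (\<Sum>n. of_nat (ovp_count positive_parts n) * q ^ n)" by (simp del: power_Suc)
  moreover have "(\<lambda>N. exp (\<Sum>n<N. ln (1 + q ^ Suc n) - ln (1 - q ^ Suc n))) \<longlonglongrightarrow> exp (ovp_log q)"
    using ovp_log_sums[OF q] unfolding sums_def by (intro tendsto_exp)
  ultimately have "(\<Sum>n. of_nat (ovp_count positive_parts n) * q ^ n) = exp (ovp_log q)"
    by (rule LIMSEQ_unique)
  moreover have "summable (\<lambda>n. of_nat (ovp_count positive_parts n) * q ^ n)"
    by (rule summable_norm_cancel) (use M in \<open>simp add: norm_mult norm_power\<close>)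
  ultimately show ?thesis by (simp add: sums_iff)
qed

section \<open>Behaviour on the real axis\<close>

definition log_coth :: "real \<Rightarrow> real" where
  "log_coth x = ln (1 + exp (- x)) - ln (1 - exp (- x))"

lemma log_coth_sums:
  assumes t: "t > 0"
  shows "(\<lambda>n. log_coth (real (Suc n) * t)) sums ovp_log (exp (- t))"
proof -
  have "exp (- t) ^ Suc n = exp (- (real (Suc n) * t))" for n
    by (simp add: exp_of_nat_mult[symmetric] del: power_Suc of_nat_Suc)
  then show ?thesis
    using ovp_log_real_sums(2)[of "exp (- t)"] t by (simp add: log_coth_def del: power_Suc of_nat_Suc)
qed

lemma log_coth_DERIV:
  assumes x: "x > 0"
  shows "(log_coth has_real_derivative (- 1 / sinh x)) (at x)"
proof -
  have e: "exp (- x) < 1" "1 + exp (- x) > 0" using x by (simp_all add: add_pos_pos)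
  have "(log_coth has_real_derivative
      (- exp (- x) / (1 + exp (- x)) - exp (- x) / (1 - exp (- x)))) (at x)"
    unfolding log_coth_def[abs_def] using e
    by (auto intro!: derivative_eq_intros simp: divide_simps)
  also have "- exp (- x) / (1 + exp (- x)) - exp (- x) / (1 - exp (- x)) = - 1 / sinh x"
  proof -
    have p: "exp x > 1" "1 + exp x > 0" using x by (simp_all add: add_pos_pos)
    then have "exp x * exp x > 1" using less_1_mult by blast
    then show ?thesis
      using p by (simp add: sinh_field_def exp_minus divide_simps) (simp add: algebra_simps)
  qed
  finally show ?thesis .
qed

lemma sinh_ge_self: "x \<ge> 0 \<Longrightarrow> sinh x \<ge> (x :: real)"
proof -
  assume x: "x \<ge> 0"
  have "sinh 0 - 0 \<le> sinh x - x"
  proof (rule DERIV_nonneg_imp_nondecreasing[OF x])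
    fix y assume "0 \<le> y" "y \<le> x"
    have "((\<lambda>y. sinh y - y) has_real_derivative (cosh y - 1)) (at y)"
      by (auto intro!: derivative_eq_intros)
    then show "\<exists>z. ((\<lambda>y. sinh y - y) has_real_derivative z) (at y) \<and> 0 \<le> z"
      using cosh_real_ge_1[of y] by (intro exI[of _ "cosh y - 1"]) simp
  qed
  then show ?thesis by simp
qed

text \<open>Removing the singularity - ln (x / 2) at 0 leaves a function that increases from 0, so
  the errors over a whole range of arguments are controlled by the value at its right end.\<close>

definition log_coth_reg :: "real \<Rightarrow> real" where
  "log_coth_reg x = log_coth x + ln (x / 2)"

lemma log_coth_reg_mono:
  assumes "0 < x" "x \<le> y"
  shows "log_coth_reg x \<le> log_coth_reg y"
proof (rule DERIV_nonneg_imp_nondecreasing[OF assms(2)])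
  fix z assume z: "x \<le> z" "z \<le> y"
  have z0: "z > 0" using assms z by simp
  have "(log_coth_reg has_real_derivative (- 1 / sinh z + 1 / z)) (at z)"
    unfolding log_coth_reg_def[abs_def] using z0
    by (auto intro!: derivative_eq_intros log_coth_DERIV)
  moreover have "- 1 / sinh z + 1 / z \<ge> 0"
    using sinh_ge_self[of z] z0 by (simp add: frac_le)
  ultimately show "\<exists>D. (log_coth_reg has_real_derivative D) (at z) \<and> 0 \<le> D" by blast
qed

lemma log_coth_reg_tendsto_0: "(log_coth_reg \<longlongrightarrow> 0) (at_right 0)"
  unfolding log_coth_reg_def[abs_def] log_coth_def by real_asymp (simp add: ln_div)

lemma log_coth_reg_nonneg:
  assumes x: "0 < x"
  shows "log_coth_reg x \<ge> 0"
proof (rule tendsto_upperbound[OF log_coth_reg_tendsto_0])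
  have "\<forall>\<^sub>F y in at_right 0. y \<in> {0<..<x}"
    using x by (rule eventually_at_right_real)
  then show "\<forall>\<^sub>F y in at_right 0. log_coth_reg y \<le> log_coth_reg x"
    by eventually_elim (auto intro: log_coth_reg_mono)
qed simp

text \<open>Convexity of \<open>log_coth\<close> in difference form: its derivative - 1 / sinh
  increases on the positive axis.\<close>

lemma log_coth_convex:
  assumes "0 < x" "x \<le> y" "t > 0"
  shows "log_coth y - log_coth (y + t) \<le> log_coth x - log_coth (x + t)"
proof (rule DERIV_nonpos_imp_nonincreasing[OF assms(2), where f = "\<lambda>x. log_coth x - log_coth (x + t)"])
  fix z assume z: "x \<le> z" "z \<le> y"
  have z0: "z > 0" using assms z by simp
  have d: "((\<lambda>x. log_coth (x + t)) has_real_derivative (- 1 / sinh (z + t))) (at z)"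
    using log_coth_DERIV[of "z + t"] z0 assms(3) by (simp add: DERIV_shift)
  have "((\<lambda>x. log_coth x - log_coth (x + t)) has_real_derivative (- 1 / sinh z - - 1 / sinh (z + t))) (at z)"
    by (intro DERIV_diff log_coth_DERIV d z0)
  moreover have "- 1 / sinh z - - 1 / sinh (z + t) \<le> 0"
    using z0 assms(3) by (simp add: frac_le)
  ultimately show "\<exists>D. ((\<lambda>x. log_coth x - log_coth (x + t)) has_real_derivative D) (at z) \<and> D \<le> 0" by blast
qed

lemma log_coth_tendsto_0: "(log_coth \<longlongrightarrow> 0) at_top"
  unfolding log_coth_def[abs_def] by real_asymp

text \<open>Doubling \<open>t\<close> keeps exactly the terms of even index, so subtracting twice
  that sum reverses their sign.\<close>

lemma alternating_log_coth_sums: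
  assumes t: "t > 0"
  shows "(\<lambda>m. log_coth (real (2 * m + 1) * t) - log_coth (real (2 * m + 2) * t)) sums
    (ovp_log (exp (- t)) - 2 * ovp_log (exp (- 2 * t)))"
proof -
  have "(\<lambda>m. \<Sum>n\<in>{m * 2..<m * 2 + 2}. log_coth (real (Suc n) * t)) sums ovp_log (exp (- t))"
    by (rule sums_group[OF log_coth_sums[OF t]]) simp
  moreover have "(\<Sum>n\<in>{m * 2..<m * 2 + 2}. log_coth (real (Suc n) * t)) =
      log_coth (real (2 * m + 1) * t) + log_coth (real (2 * m + 2) * t)" for m
  proof -
    have "{m * 2..<m * 2 + 2} = {2 * m, 2 * m + 1}" by auto
    then show ?thesis by (simp add: algebra_simps)
  qed
  ultimately have A: "(\<lambda>m. log_coth (real (2 * m + 1) * t) + log_coth (real (2 * m + 2) * t)) sums ovp_log (exp (- t))"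
    by simp
  have B: "(\<lambda>m. 2 * log_coth (real (2 * m + 2) * t)) sums (2 * ovp_log (exp (- 2 * t)))"
    using sums_mult[OF log_coth_sums[of "2 * t"], of 2] t by (simp add: algebra_simps)
  show ?thesis using sums_diff[OF A B] by (simp add: algebra_simps)
qed

lemma sums_telescope_log_coth:
  assumes t: "t > 0" and x: "x > 0"
  shows "(\<lambda>m. log_coth (x + real m * t) - log_coth (x + real (Suc m) * t)) sums log_coth x"
proof -
  have "(\<lambda>m. log_coth (x + real m * t)) \<longlonglongrightarrow> 0"
    by (rule filterlim_compose[OF log_coth_tendsto_0]) (use t in real_asymp)
  from telescope_sums'[OF this] show ?thesis by simp
qed

text \<open>By convexity the differences \<open>?d k\<close> decrease in k, and \<open>T\<close>
  adds up every other one, from k = 2 * N + 1 on. So 2 * T is at least the full telescoping sum from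
  2 * N + 1 and at most the one from 2 * N.\<close>

lemma alternating_log_coth_tail:
  assumes t: "t > 0" and N: "N > 0"
  defines "T \<equiv> \<Sum>m. log_coth (real (2 * (m + N) + 1) * t) - log_coth (real (2 * (m + N) + 2) * t)"
  shows "log_coth (real (2 * N + 1) * t) / 2 \<le> T" "T \<le> log_coth (real (2 * N) * t) / 2"
proof -
  let ?d = "\<lambda>k. log_coth (real k * t) - log_coth (real (k + 1) * t)"
  have d_mono: "?d (k + 1) \<le> ?d k" if "k > 0" for k
    using log_coth_convex[of "real k * t" "real (k + 1) * t" t] t that by (simp add: algebra_simps)
  have tel: "(\<lambda>m. ?d (2 * m + k) + ?d (2 * m + k + 1)) sums log_coth (real k * t)" if "k > 0" for k
  proof -
    have "(\<lambda>m. ?d (m + k)) sums log_coth (real k * t)"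
      using sums_telescope_log_coth[OF t, of "real k * t"] t that by (simp add: algebra_simps)
    then have "(\<lambda>m. \<Sum>n\<in>{m * 2..<m * 2 + 2}. ?d (n + k)) sums log_coth (real k * t)"
      by (rule sums_group) simp
    moreover have "(\<Sum>n\<in>{m * 2..<m * 2 + 2}. ?d (n + k)) = ?d (2 * m + k) + ?d (2 * m + k + 1)" for m
    proof -
      have "{m * 2..<m * 2 + 2} = {2 * m, 2 * m + 1}" by auto
      then show ?thesis by (simp add: algebra_simps)
    qed
    ultimately show ?thesis by simp
  qed
  have "summable (\<lambda>m. log_coth (real (2 * m + 1) * t) - log_coth (real (2 * m + 2) * t))"
    using alternating_log_coth_sums[OF t] by (simp add: sums_iff)
  then have "summable (\<lambda>m. ?d (2 * (m + N) + 1))"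
    by (subst summable_iff_shift) (simp add: add.assoc)
  moreover have T: "T = (\<Sum>m. ?d (2 * (m + N) + 1))" by (simp add: T_def add.assoc)
  ultimately have TS: "(\<lambda>m. ?d (2 * (m + N) + 1)) sums T" by (simp add: sums_iff)
  have TS2: "(\<lambda>m. 2 * ?d (2 * (m + N) + 1)) sums (2 * T)" by (rule sums_mult[OF TS])
  have "log_coth (real (2 * N + 1) * t) \<le> 2 * T"
  proof (rule sums_le[OF _ tel TS2])
    fix m
    have "?d (2 * m + (2 * N + 1) + 1) \<le> ?d (2 * m + (2 * N + 1))" by (rule d_mono) simp
    then show "?d (2 * m + (2 * N + 1)) + ?d (2 * m + (2 * N + 1) + 1) \<le> 2 * ?d (2 * (m + N) + 1)"
      by (simp add: algebra_simps)
  qed simp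
  then show "log_coth (real (2 * N + 1) * t) / 2 \<le> T" by simp
  have "2 * T \<le> log_coth (real (2 * N) * t)"
  proof (rule sums_le[OF _ TS2 tel])
    fix m
    have "?d (2 * m + 2 * N + 1) \<le> ?d (2 * m + 2 * N)" using N by (intro d_mono) simp
    then show "2 * ?d (2 * (m + N) + 1) \<le> ?d (2 * m + 2 * N) + ?d (2 * m + 2 * N + 1)"
      by (simp add: algebra_simps)
  qed (use N in simp)
  then show "T \<le> log_coth (real (2 * N) * t) / 2" by simp
qed

section \<open>Wallis' product and the doubling relation\<close>

definition log_wallis :: "nat \<Rightarrow> real" where
  "log_wallis N = (\<Sum>m<N. ln (real (2 * m + 2) / real (2 * m + 1)))"

text \<open>In Wallis' product 4 * k ^ 2 - 1 = (2 * k - 1) * (2 * k + 1), and the factors 2 * k + 1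
  repeat the factors 2 * k - 1 except for the extra 2 * n + 1. The partial product is therefore a
  square divided by 2 * n + 1, and \<open>log_wallis\<close> is the logarithm of the root of that
  square.\<close>

lemma log_wallis_tendsto: "(\<lambda>N. log_wallis N - ln (pi * real (2 * N + 1) / 2) / 2) \<longlonglongrightarrow> 0"
proof -
  have prod: "(\<Prod>k=1..n. (4 * real k ^ 2) / (4 * real k ^ 2 - 1)) = exp (2 * log_wallis n) / real (2 * n + 1)" for n
  proof (induction n)
    case 0
    then show ?case by (simp add: log_wallis_def)
  next
    case (Suc n)
    have e: "exp (2 * log_wallis (Suc n)) = exp (2 * log_wallis n) * (real (2 * n + 2) / real (2 * n + 1)) ^ 2"
    proof -
      let ?r = "real (2 * n + 2) / real (2 * n + 1)"
      have "log_wallis (Suc n) = log_wallis n + ln ?r" by (simp add: log_wallis_def)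
      then have "exp (2 * log_wallis (Suc n)) = exp (2 * log_wallis n) * (exp (ln ?r) * exp (ln ?r))"
        by (simp only: distrib_left exp_add mult_2)
      also have "exp (ln ?r) = ?r" by (rule exp_ln) (intro divide_pos_pos; simp)
      finally show ?thesis by (simp only: power2_eq_square)
    qed
    have c: "(4 * real (Suc n) ^ 2) / (4 * real (Suc n) ^ 2 - 1) =
        real (2 * n + 2) ^ 2 / (real (2 * n + 1) * real (2 * Suc n + 1))"
      by (rule arg_cong2[where f = "(/)"]) (simp_all add: power2_eq_square algebra_simps)
    have "(\<Prod>k=1..Suc n. (4 * real k ^ 2) / (4 * real k ^ 2 - 1)) =
        exp (2 * log_wallis n) / real (2 * n + 1) * (real (2 * n + 2) ^ 2 / (real (2 * n + 1) * real (2 * Suc n + 1)))"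
      unfolding c[symmetric] Suc[symmetric] by simp
    also have "\<dots> = exp (2 * log_wallis (Suc n)) / real (2 * Suc n + 1)"
      unfolding e by (simp add: power_divide power2_eq_square del: of_nat_add of_nat_mult of_nat_Suc)
    finally show ?case .
  qed
  have "(\<lambda>n. exp (2 * log_wallis n) / real (2 * n + 1)) \<longlonglongrightarrow> pi / 2"
    using wallis unfolding prod .
  then have "(\<lambda>n. ln (exp (2 * log_wallis n) / real (2 * n + 1))) \<longlonglongrightarrow> ln (pi / 2)"
    by (rule tendsto_ln) simp
  then have "(\<lambda>n. (ln (exp (2 * log_wallis n) / real (2 * n + 1)) - ln (pi / 2)) / 2) \<longlonglongrightarrow> (ln (pi / 2) - ln (pi / 2)) / 2"
    by (intro tendsto_divide tendsto_diff tendsto_const) auto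
  moreover have "(ln (exp (2 * log_wallis n) / real (2 * n + 1)) - ln (pi / 2)) / 2 =
      log_wallis n - ln (pi * real (2 * n + 1) / 2) / 2" for n
  proof -
    define c where "c = real (2 * n + 1)"
    have "c > 0" by (simp add: c_def)
    then show ?thesis unfolding c_def[symmetric] by (simp add: ln_div ln_mult field_simps)
  qed
  ultimately show ?thesis by (simp only: diff_self div_0)
qed

text \<open>
  The first \<open>2 * N\<close> terms are close to Wallis' product because \<open>log_coth x + ln (x / 2)\<close>
  increases from 0, and by convexity the tail is about half of its first term.
\<close>

lemma alternating_log_coth_bounds:
  assumes t: "t > 0" and N: "N > 0"
  defines "S \<equiv> ovp_log (exp (- t)) - 2 * ovp_log (exp (- 2 * t))"
  shows "log_wallis N - ln (pi * real (2 * N + 1) / 2) / 2 - log_coth_reg (real (2 * N) * t)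
           \<le> S - ln (pi / t) / 2"
    and "S - ln (pi / t) / 2 \<le> log_wallis N - ln (pi * real N) / 2 + log_coth_reg (real (2 * N) * t) / 2"
proof -
  let ?f = "\<lambda>k. log_coth (real k * t)" and ?g = "\<lambda>k. log_coth_reg (real k * t)"
  define T where "T = (\<Sum>m. ?f (2 * (m + N) + 1) - ?f (2 * (m + N) + 2))"
  have split: "S = (\<Sum>m<N. ?f (2 * m + 1) - ?f (2 * m + 2)) + T"
    using alternating_log_coth_sums[OF t]
      suminf_split_initial_segment[of "\<lambda>m. ?f (2 * m + 1) - ?f (2 * m + 2)" N]
    unfolding S_def T_def sums_iff by linarith
  have f: "?f k = ?g k - ln (real k * t / 2)" for k by (simp add: log_coth_reg_def)
  have "(\<Sum>m<N. ?f (2 * m + 1) - ?f (2 * m + 2)) =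
      log_wallis N - (\<Sum>m<N. ?g (2 * m + 2) - ?g (2 * m + 1))"
    unfolding log_wallis_def sum_subtractf[symmetric]
  proof (rule sum.cong[OF refl])
    fix m
    have "ln (real (2 * m + 2) * t / 2) - ln (real (2 * m + 1) * t / 2) =
        ln ((real (2 * m + 2) * t / 2) / (real (2 * m + 1) * t / 2))"
      using t by (intro ln_divide_pos[symmetric]) (auto intro!: mult_pos_pos divide_pos_pos)
    also have "(real (2 * m + 2) * t / 2) / (real (2 * m + 1) * t / 2) = real (2 * m + 2) / real (2 * m + 1)"
      using t by (simp del: of_nat_add of_nat_mult of_nat_Suc)
    finally show "?f (2 * m + 1) - ?f (2 * m + 2) =
        ln (real (2 * m + 2) / real (2 * m + 1)) - (?g (2 * m + 2) - ?g (2 * m + 1))"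
      unfolding f by simp
  qed
  moreover have "0 \<le> (\<Sum>m<N. ?g (2 * m + 2) - ?g (2 * m + 1))"
    using t by (intro sum_nonneg) (auto intro!: log_coth_reg_mono mult_right_mono)
  \<comment> \<open>Every other increment of an increasing function: with the omitted increments,
    which are nonnegative, they telescope, and the function is nonnegative where they start.\<close>
  moreover have "(\<Sum>m<M. ?g (2 * m + 2) - ?g (2 * m + 1)) \<le> ?g (2 * M)" if "M > 0" for M
    using that
  proof (induction M rule: nat_induct_non_zero)
    case 1
    then show ?case using log_coth_reg_nonneg[of t] t by simp
  next
    case (Suc M)
    have "?g (2 * M) \<le> ?g (2 * M + 1)"
      using t Suc.hyps by (intro log_coth_reg_mono) (auto intro!: mult_right_mono)
    then show ?case using Suc by simp
  qed
  ultimately have first: "log_wallis N - ?g (2 * N) \<le> S - T" "S - T \<le> log_wallis N"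
    using split N by auto
  have tail: "?f (2 * N + 1) / 2 \<le> T" "T \<le> ?f (2 * N) / 2"
    using alternating_log_coth_tail[OF t N] unfolding T_def by auto
  have g: "?g (2 * N + 1) \<ge> 0" using t by (intro log_coth_reg_nonneg) auto
  \<comment> \<open>In the tail \<open>t\<close> cancels against ln (pi / t); half of what remains
    is the value that \<open>log_wallis N\<close> approaches.\<close>
  have l: "ln (real (2 * N + 1) * t / 2) + ln (pi / t) = ln (pi * real (2 * N + 1) / 2)"
  proof -
    define c where "c = real (2 * N + 1)"
    have "c > 0" by (simp add: c_def)
    then show ?thesis unfolding c_def[symmetric] using t by (simp add: ln_div ln_mult)
  qed
  have "w - L / 2 - G \<le> S - p / 2" if "0 \<le> g" "l + p = L" "w - G \<le> S - T" "(g - l) / 2 \<le> T"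
    for w L G S p g l T :: real
    using that by argo
  from this[OF g l first(1) tail(1)[unfolded f]]
  show "log_wallis N - ln (pi * real (2 * N + 1) / 2) / 2 - ?g (2 * N) \<le> S - ln (pi / t) / 2" .
  have l: "ln (real (2 * N) * t / 2) + ln (pi / t) = ln (pi * real N)"
    using t N by (subst ln_mult_pos[symmetric]) (auto simp: field_simps)
  have "S - p / 2 \<le> w - L / 2 + g / 2" if "l + p = L" "S - T \<le> w" "T \<le> (g - l) / 2"
    for w L S p g l T :: real
    using that by argo
  from this[OF l first(2) tail(2)[unfolded f]]
  show "S - ln (pi / t) / 2 \<le> log_wallis N - ln (pi * real N) / 2 + ?g (2 * N) / 2" .
qed

lemma ovp_log_doubling:
  "((\<lambda>t. ovp_log (exp (- t)) - 2 * ovp_log (exp (- 2 * t)) - ln (pi / t) / 2) \<longlongrightarrow> 0) (at_right 0)"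
proof -
  \<comment> \<open>Two demands meet here: \<open>N t\<close> must tend to infinity for Wallis'
    product, and \<open>N t * t\<close> must tend to 0 so that the value of
    \<open>log_coth_reg\<close> at \<open>2 * N t * t\<close> vanishes in the limit.\<close>
  define N where "N t = nat \<lfloor>1 / sqrt t\<rfloor>" for t :: real
  let ?L = "\<lambda>N. log_wallis N - ln (pi * real (2 * N + 1) / 2) / 2"
  have N_top: "filterlim N at_top (at_right 0)"
    unfolding N_def
    by (rule filterlim_compose[OF filterlim_nat_sequentially], rule filterlim_compose[OF filterlim_floor_sequentially]) real_asymp
  have L: "((\<lambda>t. ?L (N t)) \<longlongrightarrow> 0) (at_right 0)"
    by (rule filterlim_compose[OF log_wallis_tendsto N_top])
  have "(\<lambda>N. ln (pi * real (2 * N + 1) / 2) / 2 - ln (pi * real N) / 2) \<longlonglongrightarrow> 0"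
    by real_asymp
  then have U: "((\<lambda>t. ln (pi * real (2 * N t + 1) / 2) / 2 - ln (pi * real (N t)) / 2) \<longlongrightarrow> 0) (at_right 0)"
    by (rule filterlim_compose[OF _ N_top])
  have small: "\<forall>\<^sub>F t in at_right 0. t > 0 \<and> N t > 0 \<and> 0 < real (2 * N t) * t \<and> real (2 * N t) * t \<le> 2 * sqrt t"
  proof -
    have "\<forall>\<^sub>F t in at_right (0::real). t > 0" by (simp add: eventually_at_right_less)
    moreover have "\<forall>\<^sub>F t in at_right 0. N t > 0"
      by (rule eventually_compose_filterlim[OF eventually_gt_at_top N_top])
    ultimately show ?thesis
    proof eventually_elim
      case (elim t)
      have "real (N t) \<le> 1 / sqrt t" using elim by (simp add: N_def)
      then have "real (N t) * t \<le> 1 / sqrt t * t" using elim by (intro mult_right_mono) auto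
      also have "\<dots> = sqrt t" using elim by (simp add: real_div_sqrt)
      finally show ?case using elim by simp
    qed
  qed
  have "((\<lambda>t. real (2 * N t) * t) \<longlongrightarrow> 0) (at_right 0)"
  proof (rule tendsto_sandwich[where f = "\<lambda>_. 0" and h = "\<lambda>t. 2 * sqrt t"])
    show "((\<lambda>t. 2 * sqrt t) \<longlongrightarrow> 0) (at_right 0)" by real_asymp
  qed (use small in \<open>auto elim: eventually_mono\<close>)
  then have "filterlim (\<lambda>t. real (2 * N t) * t) (at_right 0) (at_right 0)"
    using small by (intro filterlim_atI[where 'b = real, unfolded at_within_def] | auto simp: filterlim_at elim: eventually_mono)+
  then have R: "((\<lambda>t. log_coth_reg (real (2 * N t) * t)) \<longlongrightarrow> 0) (at_right 0)"
    by (rule filterlim_compose[OF log_coth_reg_tendsto_0])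
  show ?thesis
  proof (rule tendsto_sandwich)
    show "\<forall>\<^sub>F t in at_right 0. ?L (N t) - log_coth_reg (real (2 * N t) * t) \<le>
        ovp_log (exp (- t)) - 2 * ovp_log (exp (- 2 * t)) - ln (pi / t) / 2"
      using small by eventually_elim (use alternating_log_coth_bounds in blast)
    show "\<forall>\<^sub>F t in at_right 0. ovp_log (exp (- t)) - 2 * ovp_log (exp (- 2 * t)) - ln (pi / t) / 2 \<le>
        ?L (N t) + (ln (pi * real (2 * N t + 1) / 2) / 2 - ln (pi * real (N t)) / 2) +
        log_coth_reg (real (2 * N t) * t) / 2"
      using small
    proof eventually_elim
      case (elim t)
      then show ?case using alternating_log_coth_bounds(2)[of t "N t"] by simp
    qed
    show "((\<lambda>t. ?L (N t) - log_coth_reg (real (2 * N t) * t)) \<longlongrightarrow> 0) (at_right 0)"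
      using tendsto_diff[OF L R] by simp
    show "((\<lambda>t. ?L (N t) + (ln (pi * real (2 * N t + 1) / 2) / 2 - ln (pi * real (N t)) / 2) +
        log_coth_reg (real (2 * N t) * t) / 2) \<longlongrightarrow> 0) (at_right 0)"
      using tendsto_add[OF tendsto_add[OF L U] tendsto_divide[OF R tendsto_const[of 2]]] by simp
  qed
qed

section \<open>The leading coefficient and the expansion on the real axis\<close>

lemma inverse_odd_squares_sums: "(\<lambda>j. 2 / real (2 * j + 1) ^ 2) sums (pi\<^sup>2 / 4)"
proof -
  have s: "(\<lambda>n. 1 / real (n + 1) ^ 2) sums (pi\<^sup>2 / 6)"
    using inverse_squares_sums by simp
  have "(\<lambda>m. \<Sum>n\<in>{m * 2..<m * 2 + 2}. 1 / real (n + 1) ^ 2) sums (pi\<^sup>2 / 6)"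
    by (rule sums_group[OF s]) simp
  moreover have "(\<Sum>n\<in>{m * 2..<m * 2 + 2}. 1 / real (n + 1) ^ 2) =
      1 / real (2 * m + 1) ^ 2 + 1 / 4 * (1 / real (m + 1) ^ 2)" for m
  proof -
    have "{m * 2..<m * 2 + 2} = {2 * m, 2 * m + 1}" by auto
    moreover have "real (2 * m + 1 + 1) ^ 2 = 4 * real (m + 1) ^ 2"
      by (simp add: power2_eq_square algebra_simps)
    ultimately show ?thesis by simp
  qed
  ultimately have "(\<lambda>m. 1 / real (2 * m + 1) ^ 2 + 1 / 4 * (1 / real (m + 1) ^ 2)) sums (pi\<^sup>2 / 6)"
    by simp
  from sums_mult[OF sums_diff[OF this sums_mult[OF s, of "1 / 4"]], of 2] show ?thesis
    by (simp add: field_simps)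
qed

lemma exp_minus_div_le:
  assumes "w > 0"
  shows "exp (- w) / (1 - exp (- w)) \<le> 1 / (w :: real)"
proof -
  have "1 + w \<le> exp w" by (rule exp_ge_add_one_self)
  then have "w * exp (- w) \<le> 1 - exp (- w)"
    by (simp add: exp_minus field_simps)
  then show ?thesis using assms by (simp add: field_simps)
qed

text \<open>The doubling relation is blind to a term c / t, so its coefficient is computed directly.
  As exp (- w) / (1 - exp (- w)) \<le> 1 / w, each summand times \<open>t\<close> is bounded by its
  own limit 2 / k ^ 2, and these limits sum to pi^2 / 4 over odd k.\<close>

lemma ovp_log_leading: "((\<lambda>t. t * ovp_log (exp (- t))) \<longlongrightarrow> pi\<^sup>2 / 4) (at_right 0)"
proof -
  let ?G = "\<lambda>w::real. exp (- w) / (1 - exp (- w))"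
  let ?k = "\<lambda>j::nat. real (2 * j + 1)"
  let ?a = "\<lambda>j t. 2 / ?k j * (t * ?G (?k j * t))"
  have "((\<lambda>t. \<Sum>j. ?a j t) \<longlongrightarrow> (\<Sum>j. 2 / ?k j ^ 2)) (at_right 0)"
  proof (rule tannery_all[where M = "\<lambda>j. 2 / ?k j ^ 2"])
    fix j
    define k where "k = ?k j"
    have "k > 0" by (simp add: k_def)
    then have "((\<lambda>t. 2 / k * (t * ?G (k * t))) \<longlongrightarrow> 2 / k ^ 2) (at_right 0)"
      by real_asymp (simp add: field_simps power2_eq_square)
    then show "(?a j \<longlongrightarrow> 2 / ?k j ^ 2) (at_right 0)" by (simp add: k_def)
  next
    have "\<forall>\<^sub>F t in at_right (0::real). t > 0" by (simp add: eventually_at_right_less)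
    then show "\<forall>\<^sub>F t in at_right 0. \<forall>j. norm (?a j t) \<le> 2 / ?k j ^ 2"
    proof eventually_elim
      case (elim t)
      show ?case
      proof
        fix j
        have kt: "?k j * t > 0" using elim by simp
        have "norm (?a j t) = 2 / ?k j * (t * ?G (?k j * t))"
          using elim kt by (simp add: abs_mult del: of_nat_add of_nat_mult)
        also have "\<dots> \<le> 2 / ?k j * (t * (1 / (?k j * t)))"
          using elim by (intro mult_left_mono exp_minus_div_le kt) auto
        also have "\<dots> = 2 / ?k j ^ 2" using elim by (simp add: power2_eq_square)
        finally show "norm (?a j t) \<le> 2 / ?k j ^ 2" .
      qed
    qed
    show "summable (\<lambda>j. 2 / ?k j ^ 2)" using inverse_odd_squares_sums by (simp add: sums_iff)
  qed simp
  then have "((\<lambda>t. \<Sum>j. ?a j t) \<longlongrightarrow> pi\<^sup>2 / 4) (at_right 0)"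
    using inverse_odd_squares_sums by (simp only: sums_iff)
  moreover have "\<forall>\<^sub>F t in at_right (0::real). (\<Sum>j. ?a j t) = t * ovp_log (exp (- t))"
    using eventually_at_right_less[of 0]
  proof eventually_elim
    case (elim t)
    have e: "exp (- t) ^ (2 * j + 1) = exp (- (?k j * t))" for j
      by (simp add: exp_of_nat_mult[symmetric] algebra_simps del: power_Suc)
    have "summable (\<lambda>j. 2 / ?k j * ?G (?k j * t))"
      using summable_ovp_log[of "exp (- t)"] elim unfolding e by simp
    then have "(\<Sum>j. t * (2 / ?k j * ?G (?k j * t))) = t * ovp_log (exp (- t))"
      unfolding ovp_log_def e by (rule suminf_mult)
    then show ?case by (simp add: mult_ac)
  qed
  ultimately show ?thesis by (rule Lim_transform_eventually)
qed

text \<open>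
  Writing \<open>K t = t * (ovp_log (exp (- t)) - ln (t / (4 * pi)) / 2)\<close>, the doubling relation says
  that \<open>K (2 * t) - K t\<close> is \<open>o(t)\<close>, so that \<open>K t\<close> differs by \<open>o(t)\<close> from its limit \<open>pi\<^sup>2 / 4\<close>.
\<close>

theorem ovp_log_asymptotics:
  "((\<lambda>t. ovp_log (exp (- t)) - pi\<^sup>2 / (4 * t) - ln (t / (4 * pi)) / 2) \<longlongrightarrow> 0) (at_right 0)"
proof -
  define K where "K t = t * (ovp_log (exp (- t)) - ln (t / (4 * pi)) / 2)" for t :: real
  have K_lim: "(K \<longlongrightarrow> pi\<^sup>2 / 4) (at_right 0)"
  proof -
    have "((\<lambda>t. t * (ln (t / (4 * pi)) / 2)) \<longlongrightarrow> 0) (at_right 0)" by real_asymp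
    from tendsto_diff[OF ovp_log_leading this] show ?thesis by (simp add: K_def[abs_def] algebra_simps)
  qed
  show ?thesis
  proof (rule tendstoI)
    fix \<epsilon> :: real assume \<epsilon>: "\<epsilon> > 0"
    have "\<forall>\<^sub>F t in at_right 0. \<bar>ovp_log (exp (- t)) - 2 * ovp_log (exp (- 2 * t)) - ln (pi / t) / 2\<bar> < \<epsilon> / 2"
      using tendstoD[OF ovp_log_doubling, of "\<epsilon> / 2"] \<epsilon> by simp
    then obtain \<delta> where \<delta>: "\<delta> > 0" and bd: "\<And>t. 0 < t \<Longrightarrow> t < \<delta> \<Longrightarrow>
        \<bar>ovp_log (exp (- t)) - 2 * ovp_log (exp (- 2 * t)) - ln (pi / t) / 2\<bar> < \<epsilon> / 2"
      unfolding eventually_at_right_field by auto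
    have step: "\<bar>K (2 * t) - K t\<bar> \<le> \<epsilon> / 2 * t" if t: "0 < t" "t < \<delta>" for t
    proof -
      \<comment> \<open>The constant 4 * pi is the one for which ln (t / (4 * pi)) / 2 solves the
        doubling relation exactly.\<close>
      have l: "2 * ln (2 * t / (4 * pi)) - ln (t / (4 * pi)) = - ln (pi / t)"
      proof -
        have "2 * ln (2 * t / (4 * pi)) - ln (t / (4 * pi)) = ln ((2 * t / (4 * pi)) ^ 2 / (t / (4 * pi)))"
          using t by (subst ln_divide_pos) (auto simp: ln_realpow)
        also have "(2 * t / (4 * pi)) ^ 2 / (t / (4 * pi)) = inverse (pi / t)"
          using t by (simp add: power2_eq_square field_simps)
        also have "ln \<dots> = - ln (pi / t)" using t by (subst ln_inverse) auto
        finally show ?thesis .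
      qed
      have "K (2 * t) - K t = - (t * (ovp_log (exp (- t)) - 2 * ovp_log (exp (- 2 * t)) - ln (pi / t) / 2))"
        using l unfolding K_def by (simp add: algebra_simps) (simp add: distrib_left[symmetric] add_divide_distrib[symmetric] right_diff_distrib[symmetric])
      then show ?thesis using bd[OF t] t by (simp add: abs_mult)
    qed
    have iter: "\<bar>K t - K (t / 2 ^ j)\<bar> \<le> \<epsilon> / 2 * t" if t: "0 < t" "t < \<delta>" for t j
    proof -
      \<comment> \<open>Repeated halving costs t / 2, t / 4, ... times \<epsilon> / 2, which add up
        to the bound. The factor t in \<open>K\<close> is what makes these errors summable.\<close>
      have "\<bar>K t - K (t / 2 ^ j)\<bar> \<le> \<epsilon> / 2 * (t - t / 2 ^ j)"
      proof (induction j)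
        case (Suc j)
        have "t / 2 ^ Suc j \<le> t / 1"
          using t by (intro divide_left_mono one_le_power) auto
        then have "t / 2 ^ Suc j < \<delta>" using t by simp
        with step[of "t / 2 ^ Suc j"] t have "\<bar>K (t / 2 ^ j) - K (t / 2 ^ Suc j)\<bar> \<le> \<epsilon> / 2 * (t / 2 ^ Suc j)"
          by simp
        moreover have "\<epsilon> / 2 * (t - t / 2 ^ j) + \<epsilon> / 2 * (t / 2 ^ Suc j) = \<epsilon> / 2 * (t - t / 2 ^ Suc j)"
          by (simp add: field_simps)
        ultimately show ?case
          using Suc abs_triangle_ineq[of "K t - K (t / 2 ^ j)" "K (t / 2 ^ j) - K (t / 2 ^ Suc j)"] by simp
      qed simp
      also have "\<dots> \<le> \<epsilon> / 2 * t" using t \<epsilon> by (intro mult_left_mono) auto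
      finally show ?thesis .
    qed
    have main: "\<bar>K t - pi\<^sup>2 / 4\<bar> \<le> \<epsilon> / 2 * t" if t: "0 < t" "t < \<delta>" for t
    proof -
      have "filterlim (\<lambda>j. t / 2 ^ j) (at_right 0) sequentially"
        using t by real_asymp
      then have "(\<lambda>j. K (t / 2 ^ j)) \<longlonglongrightarrow> pi\<^sup>2 / 4"
        by (rule filterlim_compose[OF K_lim])
      then have "(\<lambda>j. \<bar>K t - K (t / 2 ^ j)\<bar>) \<longlonglongrightarrow> \<bar>K t - pi\<^sup>2 / 4\<bar>"
        by (intro tendsto_intros)
      then show ?thesis by (rule tendsto_upperbound) (use iter[OF t] in auto)
    qed
    have "\<forall>\<^sub>F t in at_right 0. t \<in> {0<..<\<delta>}" using \<delta> by (rule eventually_at_right_real)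
    then show "\<forall>\<^sub>F t in at_right 0. dist (ovp_log (exp (- t)) - pi\<^sup>2 / (4 * t) - ln (t / (4 * pi)) / 2) 0 < \<epsilon>"
    proof eventually_elim
      case (elim t)
      have "\<bar>K t - pi\<^sup>2 / 4\<bar> = t * \<bar>ovp_log (exp (- t)) - pi\<^sup>2 / (4 * t) - ln (t / (4 * pi)) / 2\<bar>"
      proof -
        have "K t - pi\<^sup>2 / 4 = t * (ovp_log (exp (- t)) - pi\<^sup>2 / (4 * t) - ln (t / (4 * pi)) / 2)"
          using elim by (simp add: K_def algebra_simps)
        then show ?thesis using elim by (simp add: abs_mult)
      qed
      then have "t * \<bar>ovp_log (exp (- t)) - pi\<^sup>2 / (4 * t) - ln (t / (4 * pi)) / 2\<bar> \<le> t * (\<epsilon> / 2)"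
        using main[of t] elim by (simp add: mult_ac)
      then have "\<bar>ovp_log (exp (- t)) - pi\<^sup>2 / (4 * t) - ln (t / (4 * pi)) / 2\<bar> \<le> \<epsilon> / 2"
        using elim by (subst (asm) mult_le_cancel_left_pos) auto
      then show ?case using \<epsilon> by simp
    qed
  qed
qed

section \<open>Behaviour near the real axis\<close>

lemma binomial_sums:
  fixes x :: real
  assumes x: "0 \<le> x" "x < 1"
  shows "(\<lambda>n. real ((n + j) choose j) * x ^ n) sums (1 / (1 - x) ^ (j + 1))"
proof (induction j)
  case 0
  then show ?case using geometric_sums[of x] x by simp
next
  case (Suc j)
  let ?a = "\<lambda>n. real ((n + j) choose j) * x ^ n"
  have "(\<lambda>n. \<Sum>i\<le>n. ?a i * x ^ (n - i)) sums ((\<Sum>n. ?a n) * (\<Sum>n. x ^ n))"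
    using Suc x by (intro Cauchy_product_sums) (auto simp: sums_iff norm_mult norm_power)
  moreover have "(\<Sum>i\<le>n. ?a i * x ^ (n - i)) = real ((n + Suc j) choose (Suc j)) * x ^ n" for n
  proof -
    have "(\<Sum>i\<le>n. ?a i * x ^ (n - i)) = (\<Sum>i\<le>n. real ((j + i) choose j)) * x ^ n"
      unfolding sum_distrib_right
      by (intro sum.cong) (auto simp: mult.assoc add.commute simp flip: power_add)
    also have "(\<Sum>i\<le>n. real ((j + i) choose j)) = real ((n + Suc j) choose (Suc j))"
      using choose_rising_sum(1)[of j n] by (simp add: add_ac flip: of_nat_sum)
    finally show ?thesis .
  qed
  moreover have "(\<Sum>n. ?a n) * (\<Sum>n. x ^ n) = 1 / (1 - x) ^ (Suc j + 1)"
    using Suc suminf_geometric[of x] x by (simp add: sums_iff mult.commute)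
  ultimately show ?case by simp
qed

lemma linear_sums:
  fixes x :: real
  assumes x: "0 \<le> x" "x < 1"
  shows "(\<lambda>n. real n * x ^ n) sums (x / (1 - x) ^ 2)"
proof -
  have "(\<lambda>n. real ((n + 1) choose 1) * x ^ n - x ^ n) sums (1 / (1 - x) ^ (1 + 1) - 1 / (1 - x))"
    using x by (intro sums_diff binomial_sums geometric_sums) auto
  also have "(\<lambda>n. real ((n + 1) choose 1) * x ^ n - x ^ n) = (\<lambda>n. real n * x ^ n)"
    by (simp add: algebra_simps)
  also have "1 / (1 - x) ^ (1 + 1) - 1 / (1 - x) = x / (1 - x) ^ 2"
    using x by (simp add: power2_eq_square divide_simps)
  finally show ?thesis .
qed

lemma twice_choose_two: "2 * real ((n + 2) choose 2) = (real n + 2) * (real n + 1)"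
proof (induction n)
  case (Suc n)
  have "(Suc n + 2) choose 2 = ((n + 2) choose 2) + (n + 2)"
    by (simp add: numeral_2_eq_2)
  then have "2 * real ((Suc n + 2) choose 2) = 2 * real ((n + 2) choose 2) + 2 * (real n + 2)" by simp
  also have "\<dots> = (real (Suc n) + 2) * (real (Suc n) + 1)" unfolding Suc by (simp add: algebra_simps)
  finally show ?case .
qed (simp add: numeral_2_eq_2)

lemma six_times_choose_three: "6 * real ((n + 2) choose 3) = real n * (real n + 1) * (real n + 2)"
proof (induction n)
  case (Suc n)
  have "(Suc n + 2) choose 3 = ((n + 2) choose 3) + ((n + 2) choose 2)"
    by (simp add: numeral_2_eq_2 numeral_3_eq_3)
  then have "6 * real ((Suc n + 2) choose 3) = 6 * real ((n + 2) choose 3) + 3 * (2 * real ((n + 2) choose 2))"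
    by simp
  also have "\<dots> = real (Suc n) * (real (Suc n) + 1) * (real (Suc n) + 2)"
    unfolding Suc twice_choose_two by (simp add: algebra_simps)
  finally show ?case .
qed simp

lemma quadratic_sums:
  fixes x :: real
  assumes x: "0 \<le> x" "x < 1"
  shows "(\<lambda>n. real n ^ 2 * x ^ n) sums (x * (1 + x) / (1 - x) ^ 3)"
proof -
  have "(\<lambda>n. 2 * (real ((n + 2) choose 2) * x ^ n) - 3 * (real n * x ^ n) - 2 * x ^ n) sums
      (2 * (1 / (1 - x) ^ (2 + 1)) - 3 * (x / (1 - x) ^ 2) - 2 * (1 / (1 - x)))"
    using x by (intro sums_diff sums_mult binomial_sums linear_sums geometric_sums) auto
  also have "(\<lambda>n. 2 * (real ((n + 2) choose 2) * x ^ n) - 3 * (real n * x ^ n) - 2 * x ^ n) =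
      (\<lambda>n. real n ^ 2 * x ^ n)"
  proof
    fix n
    show "2 * (real ((n + 2) choose 2) * x ^ n) - 3 * (real n * x ^ n) - 2 * x ^ n = real n ^ 2 * x ^ n"
      unfolding mult.assoc[symmetric] twice_choose_two by (simp add: algebra_simps power2_eq_square)
  qed
  also have "2 * (1 / (1 - x) ^ (2 + 1)) - 3 * (x / (1 - x) ^ 2) - 2 * (1 / (1 - x)) =
      x * (1 + x) / (1 - x) ^ 3"
  proof -
    have "1 - x \<noteq> 0" using x by simp
    then show ?thesis
      by (simp add: power2_eq_square power3_eq_cube divide_simps) (simp add: algebra_simps)
  qed
  finally show ?thesis .
qed

text \<open>The binomial coefficient stands in for n ^ 3 / 6, which it dominates; only an upper
  bound of a remainder is wanted, and its generating function is simpler.\<close>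

lemma cubic_sums:
  fixes x :: real
  assumes x: "0 \<le> x" "x < 1"
  shows "(\<lambda>n. real ((n + 2) choose 3) * x ^ n) sums (x / (1 - x) ^ 4)"
proof -
  have "(\<lambda>n. x * (real ((n + 3) choose 3) * x ^ n)) sums (x * (1 / (1 - x) ^ (3 + 1)))"
    using x by (intro sums_mult binomial_sums)
  then have "(\<lambda>n. real ((Suc n + 2) choose 3) * x ^ Suc n) sums (x / (1 - x) ^ 4)"
    by (simp add: mult_ac numeral_eq_Suc)
  then show ?thesis
    by (subst (asm) sums_Suc_iff) (simp add: numeral_eq_Suc)
qed

text \<open>From 1 + w \<le> exp w follow w \<le> (1 + w) * (1 - exp (- w)) and 1 + w \<le> j * exp
  (w / j). The numerator is shared out in equal parts exp (- (w / j)) among the \<open>j\<close>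
  factors of the denominator.\<close>

lemma exp_div_power_le:
  fixes w :: real
  assumes w: "w > 0" and j: "j > 0"
  shows "exp (- w) / (1 - exp (- w)) ^ j \<le> (real j / w) ^ j"
proof -
  have x: "1 - exp (- w) > 0" using w by simp
  have "1 + w \<le> exp w" by (rule exp_ge_add_one_self)
  then have "(1 + w) * exp (- w) \<le> 1" by (simp add: exp_minus field_simps)
  then have a: "w \<le> (1 + w) * (1 - exp (- w))" by (simp add: algebra_simps)
  have "w * exp (- (w / j)) \<le> ((1 + w) * (1 - exp (- w))) * exp (- (w / j))"
    using a by (intro mult_right_mono) auto
  also have "\<dots> \<le> ((real j * exp (w / j)) * (1 - exp (- w))) * exp (- (w / j))"
  proof -
    have "1 + w \<le> real j * (1 + w / j)" using j by (simp add: algebra_simps)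
    also have "\<dots> \<le> real j * exp (w / j)" by (intro mult_left_mono exp_ge_add_one_self) simp
    finally show ?thesis using x by (intro mult_right_mono) auto
  qed
  also have "\<dots> = real j * (1 - exp (- w))" by (simp add: exp_minus)
  finally have "exp (- (w / j)) / (1 - exp (- w)) \<le> real j / w"
    using x w by (simp add: field_simps)
  then have "(exp (- (w / j)) / (1 - exp (- w))) ^ j \<le> (real j / w) ^ j"
    using x by (intro power_mono) auto
  moreover have "exp (- (w / j)) ^ j = exp (- w)"
    using j by (simp add: exp_of_nat_mult[symmetric])
  ultimately show ?thesis by (simp add: power_divide)
qed

text \<open>The quantity is 1 / (4 * sinh (w / 2) ^ 2). The bounds measure how far the coefficient
  of the linear phase is from 1 / w ^ 2, the value by which \<open>ovp_local\<close> compensates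
  it.\<close>

lemma inverse_sinh_square_bounds:
  fixes w :: real
  assumes w: "w > 0"
  shows "exp (- w) / (1 - exp (- w)) ^ 2 \<le> 1 / w ^ 2"
    and "1 / w ^ 2 - 1 / w \<le> exp (- w) / (1 - exp (- w)) ^ 2"
proof -
  define y where "y = exp (- (w / 2))"
  have y: "y > 0" "y < 1" "y * y = exp (- w)" using w by (simp_all add: y_def flip: exp_add)
  have x: "1 - exp (- w) > 0" using w by simp
  have "w / 2 \<le> sinh (w / 2)" using w by (intro sinh_ge_self) auto
  also have "sinh (w / 2) = (1 / y - y) / 2" by (simp add: sinh_field_def y_def exp_minus field_simps)
  finally have "w * y \<le> 1 - exp (- w)" using y by (simp add: field_simps)
  then have "y / (1 - exp (- w)) \<le> 1 / w" using x w by (simp add: field_simps)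
  then have "(y / (1 - exp (- w))) ^ 2 \<le> (1 / w) ^ 2" using x y by (intro power_mono) auto
  then show "exp (- w) / (1 - exp (- w)) ^ 2 \<le> 1 / w ^ 2"
    using y(3) by (simp add: power_divide power2_eq_square)
  have e: "1 - w \<le> exp (- w)" using exp_ge_add_one_self[of "- w"] by simp
  have "1 / w ^ 2 - 1 / w = (1 - w) / w ^ 2" using w by (simp add: field_simps power2_eq_square)
  also have "\<dots> \<le> exp (- w) / w ^ 2" using e by (intro divide_right_mono) auto
  also have "\<dots> \<le> exp (- w) / (1 - exp (- w)) ^ 2"
    using x e by (intro divide_left_mono power_mono mult_pos_pos zero_less_power w) auto
  finally show "1 / w ^ 2 - 1 / w \<le> exp (- w) / (1 - exp (- w)) ^ 2" .
qed

lemma norm_cis_taylor: "norm (cis y - 1 - \<i> * of_real y + of_real (y ^ 2 / 2)) \<le> \<bar>y\<bar> ^ 3 / 6"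
proof -
  have "(\<Sum>k\<le>2. (\<i> * complex_of_real y) ^ k / fact k) = 1 + \<i> * y - of_real (y ^ 2 / 2)"
    by (simp add: numeral_2_eq_2 power_mult_distrib)
  with iexp_approx1[of y 2] show ?thesis
    by (simp add: cis_conv_exp algebra_simps fact_numeral numeral_eq_Suc)
qed

text \<open>In the series of q ^ n the factor cis (n * v) is expanded to second order term by term,
  and the moments of the geometric series collect the coefficients. The remainder carries the third
  moment, which is of size 1 / w ^ 4.\<close>

lemma geometric_expansion:
  fixes w v :: real
  assumes w: "w > 0"
  defines "x \<equiv> exp (- w)"
  defines "q \<equiv> of_real x * cis v"
  shows "norm (q / (1 - q) - of_real (x / (1 - x)) - \<i> * of_real (v * (x / (1 - x) ^ 2))
      + of_real (v ^ 2 / 2 * (x * (1 + x) / (1 - x) ^ 3))) \<le> \<bar>v\<bar> ^ 3 * (4 / w) ^ 4"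
proof -
  have x: "0 < x" "x < 1" using w by (simp_all add: x_def)
  have q: "norm q < 1" using x by (simp add: q_def norm_mult)
  then have q1: "1 - q \<noteq> 0" by auto
  have "(\<lambda>n. q ^ n - of_real (x ^ n) - \<i> * of_real (v * (real n * x ^ n)) + of_real (v ^ 2 / 2 * (real n ^ 2 * x ^ n)))
      sums (1 / (1 - q) - of_real (1 / (1 - x)) - \<i> * of_real (v * (x / (1 - x) ^ 2))
      + of_real (v ^ 2 / 2 * (x * (1 + x) / (1 - x) ^ 3)))" (is "?f sums ?F")
    using x q
    by (intro sums_add sums_diff sums_mult sums_of_real geometric_sums linear_sums quadratic_sums) auto
  moreover have "(\<lambda>n. \<bar>v\<bar> ^ 3 * (real ((n + 2) choose 3) * x ^ n)) sums (\<bar>v\<bar> ^ 3 * (x / (1 - x) ^ 4))"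
    using x by (intro sums_mult cubic_sums) auto
  moreover have "norm (?f n) \<le> \<bar>v\<bar> ^ 3 * (real ((n + 2) choose 3) * x ^ n)" for n
  proof -
    define y where "y = real n * v"
    have "?f n = of_real (x ^ n) * (cis y - 1 - \<i> * of_real y + of_real (y ^ 2 / 2))"
      by (simp add: q_def y_def power_mult_distrib Complex.DeMoivre algebra_simps)
    then have "norm (?f n) = x ^ n * norm (cis y - 1 - \<i> * of_real y + of_real (y ^ 2 / 2))"
      using x by (simp only: norm_mult norm_of_real) simp
    also have "\<dots> \<le> x ^ n * (\<bar>y\<bar> ^ 3 / 6)"
      using x by (intro mult_left_mono norm_cis_taylor) auto
    also have "\<dots> = \<bar>v\<bar> ^ 3 * (x ^ n * (real n ^ 3 / 6))"
      by (simp add: y_def abs_mult power_mult_distrib)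
    also have "\<dots> \<le> \<bar>v\<bar> ^ 3 * (x ^ n * real ((n + 2) choose 3))"
    proof (intro mult_left_mono)
      have "real n ^ 3 = real n * real n * real n" by (simp add: power3_eq_cube)
      also have "\<dots> \<le> real n * (real n + 1) * (real n + 2)" by (intro mult_mono) auto
      finally show "real n ^ 3 / 6 \<le> real ((n + 2) choose 3)"
        using six_times_choose_three[of n] by simp
    qed (use x in auto)
    finally show ?thesis by (simp add: mult_ac)
  qed
  ultimately have "norm ?F \<le> \<bar>v\<bar> ^ 3 * (x / (1 - x) ^ 4)"
    by (rule norm_sums_le)
  also have "\<dots> \<le> \<bar>v\<bar> ^ 3 * (4 / w) ^ 4"
    using exp_div_power_le[OF w, of 4] by (intro mult_left_mono) (auto simp: x_def)
  \<comment> \<open>The series begin at n = 0; the constants 1 split off here and in the next step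
    cancel each other.\<close>
  also have "1 / (1 - q) = q / (1 - q) + 1" using q1 by (simp add: divide_simps)
  also have "1 / (1 - x) = x / (1 - x) + 1" using x by (simp add: divide_simps)
  finally show ?thesis by (simp add: algebra_simps)
qed

section \<open>The exponent near the positive real axis\<close>

lemma polar_power:
  "(of_real (exp (- t)) * cis \<theta>) ^ k = of_real (exp (- (real k * t))) * cis (real k * \<theta>)"
proof -
  have "exp (- t) ^ k = exp (- (real k * t))" by (subst exp_of_nat_mult[symmetric]) simp
  then show ?thesis by (simp only: power_mult_distrib Complex.DeMoivre of_real_power[symmetric])
qed

lemma summable_odd_inverse_three_halves: "summable (\<lambda>j. 1 / (real (2 * j + 1) * sqrt (real (2 * j + 1))))"
proof (rule summable_comparison_test')
  show "summable (\<lambda>j. real (Suc j) powr (- 3 / 2))"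
    by (subst summable_Suc_iff[of "\<lambda>j. real j powr (- 3 / 2)"]) (simp add: summable_real_powr_iff)
  fix j :: nat
  have "1 / (real (2 * j + 1) * sqrt (real (2 * j + 1))) \<le> 1 / (real (Suc j) * sqrt (real (Suc j)))"
    by (intro divide_left_mono mult_mono real_sqrt_le_mono mult_pos_pos) auto
  also have "\<dots> = real (Suc j) powr (- 3 / 2)"
  proof -
    have "real (Suc j) powr (- 3 / 2) = 1 / real (Suc j) powr (1 + 1 / 2)"
      by (simp add: powr_minus_divide[symmetric] del: of_nat_Suc)
    also have "real (Suc j) powr (1 + 1 / 2) = real (Suc j) * sqrt (real (Suc j))"
      by (subst powr_add) (simp add: powr_half_sqrt del: of_nat_Suc)
    finally show ?thesis by simp
  qed
  finally show "norm (1 / (real (2 * j + 1) * sqrt (real (2 * j + 1)))) \<le> real (Suc j) powr (- 3 / 2)"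
    by simp
qed

text \<open>Exponent of the normalized Cauchy integrand. The last term stands for the phase - n *
  \<theta>: it uses the leading form pi^2 / (4 * t^2) of the slope, which equals n for the radius
  chosen, and not the exact derivative of the logarithm.\<close>

definition ovp_local :: "real \<Rightarrow> real \<Rightarrow> complex" where
  "ovp_local t \<theta> = ovp_log (of_real (exp (- t)) * cis \<theta>) - of_real (ovp_log (exp (- t)))
     - \<i> * of_real (pi\<^sup>2 / (4 * t\<^sup>2) * \<theta>)"

text \<open>As 2 / k ^ 2 sums to pi^2 / 4 over odd k, the linear phase can be shared out so that
  each \<open>k\<close> carries its own compensation; this is what permits a termwise limit.\<close>

lemma ovp_local_sums:
  assumes t: "t > 0"
  shows "(\<lambda>j. let k = real (2 * j + 1); x = exp (- (k * t)); q = of_real x * cis (k * \<theta>) in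
      of_real (2 / k) * (q / (1 - q) - of_real (x / (1 - x)) - \<i> * of_real (k * \<theta> * (1 / (k * t) ^ 2))))
    sums ovp_local t \<theta>"
proof -
  let ?q = "of_real (exp (- t)) * cis \<theta>"
  have q: "norm ?q < 1" using t by (simp add: norm_mult)
  have "(\<lambda>j. 2 / of_nat (2 * j + 1) * (?q ^ (2 * j + 1) / (1 - ?q ^ (2 * j + 1)))) sums ovp_log ?q"
    unfolding ovp_log_def by (rule summable_sums[OF summable_ovp_log[OF q]])
  moreover have "(\<lambda>j. of_real (2 / of_nat (2 * j + 1) * (exp (- t) ^ (2 * j + 1) / (1 - exp (- t) ^ (2 * j + 1)))))
      sums complex_of_real (ovp_log (exp (- t)))"
    unfolding ovp_log_def using t by (intro sums_of_real summable_sums summable_ovp_log) simp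
  moreover have "(\<lambda>j. \<i> * of_real (2 / real (2 * j + 1) ^ 2 * (\<theta> / t\<^sup>2))) sums (\<i> * of_real (pi\<^sup>2 / 4 * (\<theta> / t\<^sup>2)))"
    by (intro sums_mult sums_of_real sums_mult2 inverse_odd_squares_sums)
  ultimately have "(\<lambda>j. 2 / of_nat (2 * j + 1) * (?q ^ (2 * j + 1) / (1 - ?q ^ (2 * j + 1))) -
      of_real (2 / of_nat (2 * j + 1) * (exp (- t) ^ (2 * j + 1) / (1 - exp (- t) ^ (2 * j + 1)))) -
      \<i> * of_real (2 / real (2 * j + 1) ^ 2 * (\<theta> / t\<^sup>2))) sums
      (ovp_log ?q - of_real (ovp_log (exp (- t))) - \<i> * of_real (pi\<^sup>2 / 4 * (\<theta> / t\<^sup>2)))"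
    by (intro sums_diff)
  also have "ovp_log ?q - of_real (ovp_log (exp (- t))) - \<i> * of_real (pi\<^sup>2 / 4 * (\<theta> / t\<^sup>2)) = ovp_local t \<theta>"
    by (simp add: ovp_local_def)
  finally show ?thesis
  proof (rule sums_cong[THEN iffD1, rotated])
    fix j
    define k where "k = real (2 * j + 1)"
    have k: "k > 0" by (simp add: k_def)
    have e: "exp (- t) ^ (2 * j + 1) = exp (- (k * t))"
      unfolding k_def by (subst exp_of_nat_mult[symmetric]) simp
    have c: "of_nat (2 * j + 1) = complex_of_real k" "of_nat (2 * j + 1) = k" by (simp_all add: k_def)
    show "2 / of_nat (2 * j + 1) * (?q ^ (2 * j + 1) / (1 - ?q ^ (2 * j + 1))) -
      of_real (2 / of_nat (2 * j + 1) * (exp (- t) ^ (2 * j + 1) / (1 - exp (- t) ^ (2 * j + 1)))) -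
      \<i> * of_real (2 / real (2 * j + 1) ^ 2 * (\<theta> / t\<^sup>2)) =
      (let k = real (2 * j + 1); x = exp (- (k * t)); q = of_real x * cis (k * \<theta>) in
      of_real (2 / k) * (q / (1 - q) - of_real (x / (1 - x)) - \<i> * of_real (k * \<theta> * (1 / (k * t) ^ 2))))"
      unfolding polar_power e k_def[symmetric] Let_def c using k t
      by (simp add: right_diff_distrib power_mult_distrib power2_eq_square mult_ac)
  qed
qed

text \<open>At the angle t * sqrt t * v each term is 2 / k times the combination of a cubic
  remainder \<open>R\<close> of size sqrt t / k, a mismatch \<open>U\<close> in the linear phase
  that tends to 0, and a quadratic part \<open>V\<close> that tends to 1 / k. The limits - 2 / k ^ 2
  * v ^ 2 sum to the Gaussian exponent; the bound of \<open>U\<close> dictates the common majorant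
  of order k powr (- 3 / 2).\<close>

theorem ovp_local_tendsto:
  "((\<lambda>t. ovp_local t (t * sqrt t * v)) \<longlongrightarrow> of_real (- (pi\<^sup>2 / 4 * v\<^sup>2))) (at_right 0)"
proof -
  define x where "x k t = exp (- (k * t))" for k t :: real
  define q where "q k t = of_real (x k t) * cis (k * (t * sqrt t * v))" for k t
  define R where "R k t = q k t / (1 - q k t) - of_real (x k t / (1 - x k t))
      - \<i> * of_real (k * (t * sqrt t * v) * (x k t / (1 - x k t) ^ 2))
      + of_real ((k * (t * sqrt t * v)) ^ 2 / 2 * (x k t * (1 + x k t) / (1 - x k t) ^ 3))" for k t
  define U where "U k t = k * (t * sqrt t) * (x k t / (1 - x k t) ^ 2 - 1 / (k * t) ^ 2)" for k t
  define V where "V k t = (k * (t * sqrt t)) ^ 2 / 2 * (x k t * (1 + x k t) / (1 - x k t) ^ 3)" for k t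
  define a where "a k t = of_real (2 / k) * (R k t + \<i> * of_real (v * U k t) - of_real (v\<^sup>2 * V k t))" for k t
  let ?k = "\<lambda>j::nat. real (2 * j + 1)"
  \<comment> \<open>256 = 4 ^ 4 and 27 = 3 ^ 3 come from the powers (j / w) ^ j of
    \<open>exp_div_power_le\<close> with j = 4 and j = 3.\<close>
  define C where "C = 256 * \<bar>v\<bar> ^ 3 + \<bar>v\<bar> + 27 * v\<^sup>2"

  have R_bound: "norm (R k t) \<le> 256 * \<bar>v\<bar> ^ 3 * (sqrt t / k)" if "k > 0" "t > 0" for k t
  proof -
    have "norm (R k t) \<le> \<bar>k * (t * sqrt t * v)\<bar> ^ 3 * (4 / (k * t)) ^ 4"
      unfolding R_def q_def x_def using that by (intro geometric_expansion) auto
    also have "\<dots> = 256 * \<bar>v\<bar> ^ 3 * (sqrt t / k)"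
    proof -
      have "(sqrt t) ^ 3 = t * sqrt t" using that by (simp add: power3_eq_cube)
      then show ?thesis
        using that by (simp add: abs_mult power_mult_distrib power_divide)
          (simp add: power3_eq_cube power4_eq_xxxx field_simps)
    qed
    finally show ?thesis .
  qed
  have U_bound: "\<bar>U k t\<bar> \<le> 1 / sqrt k" if "k > 0" "t > 0" for k t
  proof -
    define w where "w = k * t"
    have w: "w > 0" using that by (simp add: w_def)
    \<comment> \<open>Between 1 / w ^ 2 and 1 / w lies w powr (- 3 / 2), the power for which the
      factor k * t powr (3 / 2) leaves no \<open>t\<close> and still gains k powr (- 1 / 2).\<close>
    have "\<bar>x k t / (1 - x k t) ^ 2 - 1 / w ^ 2\<bar> \<le> min (1 / w ^ 2) (1 / w)"
    proof -
      have "x k t / (1 - x k t) ^ 2 \<ge> 0" by (simp add: x_def)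
      then show ?thesis
        using inverse_sinh_square_bounds[OF w] unfolding x_def w_def[symmetric] by auto
    qed
    also have "\<dots> \<le> 1 / (w * sqrt w)"
    proof (cases "w \<le> 1")
      case True
      then have "sqrt w \<le> 1" using w by simp
      then have "w * sqrt w \<le> w * 1" using w by (intro mult_left_mono) auto
      then have "1 / w \<le> 1 / (w * sqrt w)" using w by (intro divide_left_mono) auto
      then show ?thesis by simp
    next
      case False
      then have "sqrt w * 1 \<le> sqrt w * sqrt w" by (intro mult_left_mono) auto
      then have "sqrt w \<le> w" using w by simp
      then have "w * sqrt w \<le> w * w" using w by (intro mult_left_mono) auto
      then have "1 / w ^ 2 \<le> 1 / (w * sqrt w)" using w unfolding power2_eq_square
        by (intro divide_left_mono) auto
      then show ?thesis by simp
    qed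
    finally have "k * (t * sqrt t) * \<bar>x k t / (1 - x k t) ^ 2 - 1 / w ^ 2\<bar> \<le> k * (t * sqrt t) * (1 / (w * sqrt w))"
      using that by (intro mult_left_mono) auto
    also have "\<dots> = 1 / sqrt k" using that by (simp add: w_def real_sqrt_mult field_simps)
    finally show ?thesis using that by (simp add: U_def w_def abs_mult)
  qed
  have V_bound: "\<bar>V k t\<bar> \<le> 27 / k" if "k > 0" "t > 0" for k t
  proof -
    have x: "0 < x k t" "x k t < 1" using that by (simp_all add: x_def)
    have s: "(sqrt t) ^ 2 = t" using that by simp
    have "x k t * (1 + x k t) / (1 - x k t) ^ 3 \<le> 2 * (x k t / (1 - x k t) ^ 3)"
      using x by (simp add: divide_right_mono)
    also have "x k t / (1 - x k t) ^ 3 \<le> (3 / (k * t)) ^ 3"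
      using exp_div_power_le[of "k * t" 3] that by (simp add: x_def)
    finally have "V k t \<le> (k * (t * sqrt t)) ^ 2 / 2 * (2 * (3 / (k * t)) ^ 3)"
      unfolding V_def using that by (intro mult_left_mono) auto
    also have "\<dots> = 27 / k" using that
      by (simp add: power_mult_distrib power_divide s) (simp add: power3_eq_cube power2_eq_square field_simps)
    finally show ?thesis using x that by (simp add: V_def)
  qed
  have a_eq: "a k t = of_real (2 / k) * (q k t / (1 - q k t) - of_real (x k t / (1 - x k t))
      - \<i> * of_real (k * (t * sqrt t * v) * (1 / (k * t) ^ 2)))" for k t
    by (simp add: a_def R_def U_def V_def algebra_simps power_mult_distrib)
  have a_bound: "norm (a k t) \<le> 2 * C * (1 / (k * sqrt k))" if k: "k \<ge> 1" and t: "t > 0" "t \<le> 1" for k t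
  proof -
    have sk: "1 / k \<le> 1 / sqrt k"
    proof -
      have "sqrt k * 1 \<le> sqrt k * sqrt k" using k by (intro mult_left_mono) auto
      then have "sqrt k \<le> k" using k by simp
      then show ?thesis using k by (intro divide_left_mono) auto
    qed
    have "norm (R k t + \<i> * of_real (v * U k t) - of_real (v\<^sup>2 * V k t)) \<le>
        norm (R k t) + \<bar>v\<bar> * \<bar>U k t\<bar> + v\<^sup>2 * \<bar>V k t\<bar>"
      by (rule order.trans[OF norm_triangle_ineq4] add_mono order.trans[OF norm_triangle_ineq])+
         (auto simp: norm_mult norm_power abs_mult)
    also have "\<dots> \<le> 256 * \<bar>v\<bar> ^ 3 * (1 / sqrt k) + \<bar>v\<bar> * (1 / sqrt k) + v\<^sup>2 * (27 * (1 / sqrt k))"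
    proof (intro add_mono mult_left_mono)
      have "sqrt t / k \<le> 1 / k" using t k by (intro divide_right_mono) auto
      then have "256 * \<bar>v\<bar> ^ 3 * (sqrt t / k) \<le> 256 * \<bar>v\<bar> ^ 3 * (1 / sqrt k)"
        using sk by (intro mult_left_mono) auto
      then show "norm (R k t) \<le> 256 * \<bar>v\<bar> ^ 3 * (1 / sqrt k)"
        using R_bound[of k t] k t by simp
      show "\<bar>U k t\<bar> \<le> 1 / sqrt k" using U_bound k t by simp
      show "\<bar>V k t\<bar> \<le> 27 * (1 / sqrt k)" using V_bound[of k t] sk k t by simp
    qed auto
    also have "\<dots> = C * (1 / sqrt k)" by (simp add: C_def algebra_simps)
    finally have "2 / k * norm (R k t + \<i> * of_real (v * U k t) - of_real (v\<^sup>2 * V k t)) \<le> 2 / k * (C * (1 / sqrt k))"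
      using k by (intro mult_left_mono) auto
    moreover have "norm (a k t) = 2 / k * norm (R k t + \<i> * of_real (v * U k t) - of_real (v\<^sup>2 * V k t))"
    proof -
      have "norm (complex_of_real (2 / k)) = 2 / k" using k by (simp only: norm_of_real) simp
      then show ?thesis by (simp only: a_def norm_mult)
    qed
    ultimately show ?thesis by simp
  qed
  have a_lim: "(a k \<longlongrightarrow> of_real (- (2 / k ^ 2 * v\<^sup>2))) (at_right 0)" if k: "k > 0" for k
  proof -
    have "(R k \<longlongrightarrow> 0) (at_right 0)"
    proof (rule Lim_null_comparison)
      show "\<forall>\<^sub>F t in at_right 0. norm (R k t) \<le> 256 * \<bar>v\<bar> ^ 3 * (sqrt t / k)"
        using eventually_at_right_less[of 0] by eventually_elim (use R_bound k in auto)
      have "((\<lambda>t. sqrt t / k) \<longlongrightarrow> 0) (at_right 0)" using k by real_asymp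
      from tendsto_mult_left[OF this, of "256 * \<bar>v\<bar> ^ 3"]
      show "((\<lambda>t. 256 * \<bar>v\<bar> ^ 3 * (sqrt t / k)) \<longlongrightarrow> 0) (at_right 0)" by simp
    qed
    moreover have "(U k \<longlongrightarrow> 0) (at_right 0)"
      unfolding U_def[abs_def] x_def using k by real_asymp
    moreover have "(V k \<longlongrightarrow> 1 / k) (at_right 0)"
      unfolding V_def[abs_def] x_def using k by real_asymp (simp add: field_simps power2_eq_square power3_eq_cube)
    ultimately have "(a k \<longlongrightarrow> of_real (2 / k) * (0 + \<i> * of_real (v * 0) - of_real (v\<^sup>2 * (1 / k)))) (at_right 0)"
      unfolding a_def[abs_def] by (intro tendsto_intros)
    also have "of_real (2 / k) * (0 + \<i> * of_real (v * 0) - of_real (v\<^sup>2 * (1 / k))) = complex_of_real (- (2 / k ^ 2 * v\<^sup>2))"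
      by (simp add: power2_eq_square)
    finally show ?thesis .
  qed
  have "((\<lambda>t. \<Sum>j. a (?k j) t) \<longlongrightarrow> (\<Sum>j. of_real (- (2 / ?k j ^ 2 * v\<^sup>2)))) (at_right 0)"
  proof (rule tannery_all)
    show "(a (?k j) \<longlongrightarrow> of_real (- (2 / ?k j ^ 2 * v\<^sup>2))) (at_right 0)" for j
      by (rule a_lim) simp
    show "summable (\<lambda>j. 2 * C * (1 / (?k j * sqrt (?k j))))"
      by (intro summable_mult summable_odd_inverse_three_halves)
    have "\<forall>\<^sub>F t in at_right (0::real). t \<in> {0<..<1}" by (rule eventually_at_right_real) simp
    then show "\<forall>\<^sub>F t in at_right 0. \<forall>j. norm (a (?k j) t) \<le> 2 * C * (1 / (?k j * sqrt (?k j)))"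
      by eventually_elim (intro allI a_bound; simp)
  qed simp
  moreover have "(\<Sum>j. complex_of_real (- (2 / ?k j ^ 2 * v\<^sup>2))) = of_real (- (pi\<^sup>2 / 4 * v\<^sup>2))"
    by (intro sums_unique[symmetric] sums_of_real sums_minus sums_mult2 inverse_odd_squares_sums)
  ultimately have lim: "((\<lambda>t. \<Sum>j. a (?k j) t) \<longlongrightarrow> of_real (- (pi\<^sup>2 / 4 * v\<^sup>2))) (at_right 0)"
    by (simp only:)
  have "\<forall>\<^sub>F t in at_right 0. (\<Sum>j. a (?k j) t) = ovp_local t (t * sqrt t * v)"
    using eventually_at_right_less[of 0]
  proof eventually_elim
    case (elim t)
    show ?case
      using ovp_local_sums[OF elim, of "t * sqrt t * v"]
      unfolding Let_def a_eq x_def q_def by (rule sums_unique[symmetric])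
  qed
  with lim show ?thesis by (rule Lim_transform_eventually)
qed

section \<open>A majorant on the whole circle\<close>

lemma sin_ge_third:
  assumes "0 \<le> x" "x \<le> pi / 2"
  shows "x / 3 \<le> sin x"
proof -
  have "\<bar>sin x - x\<bar> \<le> x ^ 3 / 6"
  proof -
    have "(\<Sum>m<3. sin_coeff m * x ^ m) = x" by (simp add: sin_coeff_def eval_nat_numeral)
    then show ?thesis using Maclaurin_sin_bound[of x 3] assms by (simp add: fact_numeral)
  qed
  moreover have "x ^ 3 \<le> 4 * x"
  proof -
    have "x < 2" using assms pi_less_4 by simp
    then have "x * x \<le> 2 * 2" using assms by (intro mult_mono) auto
    from mult_right_mono[OF this assms(1)] show ?thesis by (simp add: power3_eq_cube)
  qed
  ultimately show ?thesis by linarith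
qed

text \<open>As 1 - cos \<theta> = 2 * sin (\<theta> / 2) ^ 2 and sin x \<ge> x / 3 up to pi / 2, the
  constant is 2 * (1 / 6) ^ 2 = 1 / 18.\<close>

lemma one_minus_cos_ge:
  assumes "\<bar>\<theta>\<bar> \<le> pi"
  shows "\<theta>\<^sup>2 / 18 \<le> 1 - cos \<theta>"
proof -
  have "(\<bar>\<theta>\<bar> / 2 / 3) ^ 2 \<le> sin (\<bar>\<theta>\<bar> / 2) ^ 2"
    using assms by (intro power_mono sin_ge_third) auto
  moreover have "cos \<bar>\<theta>\<bar> = 1 - 2 * sin (\<bar>\<theta>\<bar> / 2) ^ 2"
    using cos_double_sin[of "\<bar>\<theta>\<bar> / 2"] by simp
  ultimately show ?thesis by (simp add: power_divide)
qed

text \<open>Exact because the squared modulus of 1 - q is (1 - r)^2 + 2 * r * u. The closed form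
  shows both that the difference is nonnegative, which settles every k, and how large it is, which
  is needed for k = 1.\<close>

lemma Re_geometric_polar:
  fixes r \<theta> :: real
  assumes r: "0 < r" "r < 1"
  defines "q \<equiv> of_real r * cis \<theta>" and "u \<equiv> 1 - cos \<theta>"
  shows "r / (1 - r) - Re (q / (1 - q)) = r * (1 + r) * u / ((1 - r) * ((1 - r)\<^sup>2 + 2 * r * u))"
proof -
  have u: "u \<ge> 0" by (simp add: u_def)
  define N where "N = (1 - r)\<^sup>2 + 2 * r * u"
  have N: "N > 0" using r u by (simp add: N_def add_pos_nonneg)
  have sc: "(sin \<theta>)\<^sup>2 = 1 - (cos \<theta>)\<^sup>2" by (simp add: sin_squared_eq)
  have "(Re (1 - q))\<^sup>2 + (Im (1 - q))\<^sup>2 = N"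
    by (simp add: q_def N_def u_def power_mult_distrib sc) (simp add: power2_eq_square algebra_simps)
  then have "Re (q / (1 - q)) = (Re q * Re (1 - q) + Im q * Im (1 - q)) / N"
    by (simp add: Re_divide)
  also have "Re q * Re (1 - q) + Im q * Im (1 - q) = r * cos \<theta> - r\<^sup>2 * (cos \<theta>)\<^sup>2 - r\<^sup>2 * (sin \<theta>)\<^sup>2"
    by (simp add: q_def algebra_simps power2_eq_square)
  also have "\<dots> = r * (1 - u) - r\<^sup>2" unfolding sc by (simp add: u_def algebra_simps)
  finally have Re_q: "Re (q / (1 - q)) = (r * (1 - u) - r\<^sup>2) / N" .
  have "r / (1 - r) - Re (q / (1 - q)) = (r * N - (r * (1 - u) - r\<^sup>2) * (1 - r)) / ((1 - r) * N)"
    unfolding Re_q using r N by (intro diff_frac_eq) auto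
  also have "r * N - (r * (1 - u) - r\<^sup>2) * (1 - r) = r * (1 + r) * u"
    by (simp add: N_def algebra_simps power2_eq_square)
  finally show ?thesis by (simp add: N_def)
qed

lemma Re_ovp_log_le:
  assumes r: "0 < r" "r < 1"
  shows "Re (ovp_log (of_real r * cis \<theta>)) - ovp_log r \<le>
    - (2 * (r * (1 + r) * (1 - cos \<theta>) / ((1 - r) * ((1 - r)\<^sup>2 + 2 * r * (1 - cos \<theta>)))))"
proof -
  let ?q = "of_real r * cis \<theta>"
  let ?G = "\<lambda>j. ?q ^ (2 * j + 1) / (1 - ?q ^ (2 * j + 1))"
  let ?g = "\<lambda>j. r ^ (2 * j + 1) / (1 - r ^ (2 * j + 1))"
  have q: "norm ?q < 1" using r by (simp add: norm_mult)
  let ?d = "\<lambda>j. 2 / real (2 * j + 1) * (?g j - Re (?G j))"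
  have "(\<lambda>j. 2 / of_nat (2 * j + 1) * ?G j) sums ovp_log ?q"
    unfolding ovp_log_def by (rule summable_sums[OF summable_ovp_log[OF q]])
  then have "(\<lambda>j. Re (2 / of_nat (2 * j + 1) * ?G j)) sums Re (ovp_log ?q)"
    by (rule sums_Re)
  moreover have "Re (2 / of_nat (2 * j + 1) * z) = 2 / real (2 * j + 1) * Re z" for j z
  proof -
    have "2 / of_nat (2 * j + 1) = complex_of_real (2 / real (2 * j + 1))" by simp
    then show ?thesis by (simp only: Re_complex_of_real times_complex.sel Im_complex_of_real mult_zero_left diff_zero)
  qed
  ultimately have "(\<lambda>j. 2 / real (2 * j + 1) * Re (?G j)) sums Re (ovp_log ?q)" by (simp only:)
  moreover have "(\<lambda>j. 2 / of_nat (2 * j + 1) * ?g j) sums ovp_log r"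
    unfolding ovp_log_def using r by (intro summable_sums summable_ovp_log) simp
  ultimately have "(\<lambda>j. 2 / real (2 * j + 1) * ?g j - 2 / real (2 * j + 1) * Re (?G j)) sums (ovp_log r - Re (ovp_log ?q))"
    by (intro sums_diff)
  then have d: "?d sums (ovp_log r - Re (ovp_log ?q))" by (simp only: right_diff_distrib)
  have polar: "?q ^ m = of_real (r ^ m) * cis (real m * \<theta>)" for m
    by (simp add: power_mult_distrib Complex.DeMoivre)
  have nonneg: "?d j \<ge> 0" for j
  proof -
    have rm: "0 < r ^ (2 * j + 1)" "r ^ (2 * j + 1) < 1"
      using r by (simp, intro power_Suc_less_one[of r "2 * j", unfolded Suc_eq_plus1]) auto
    have "?g j - Re (?G j) \<ge> 0"
      unfolding polar Re_geometric_polar[OF rm] using rm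
      by (intro divide_nonneg_nonneg mult_nonneg_nonneg add_nonneg_nonneg) auto
    then show ?thesis by (intro mult_nonneg_nonneg) auto
  qed
  have "(\<Sum>j<1. ?d j) \<le> (\<Sum>j. ?d j)"
    using d nonneg by (intro sum_le_suminf) (auto simp: sums_iff)
  also have "(\<Sum>j. ?d j) = ovp_log r - Re (ovp_log ?q)" using d by (simp only: sums_iff)
  also have "(\<Sum>j<1. ?d j) = 2 * (r / (1 - r) - Re (?q / (1 - ?q)))" by simp
  finally show ?thesis unfolding Re_geometric_polar[OF r] by linarith
qed

lemma Re_ovp_log_le_exp:
  assumes t: "0 < t" "t \<le> 1" and \<theta>: "\<bar>\<theta>\<bar> \<le> pi"
  shows "Re (ovp_log (of_real (exp (- t)) * cis \<theta>)) - ovp_log (exp (- t)) \<le>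
    - (\<theta>\<^sup>2 / (27 * (t * (t\<^sup>2 + \<theta>\<^sup>2))))"
proof -
  define r u where "r = exp (- t)" and "u = 1 - cos \<theta>"
  have r: "0 < r" "r < 1" using t by (simp_all add: r_def)
  have r3: "1 / 3 \<le> r"
  proof -
    have "exp (- 1) \<le> r" using t by (simp add: r_def)
    moreover have "1 / 3 \<le> exp (- 1 :: real)" using exp_le by (simp add: exp_minus field_simps)
    ultimately show ?thesis by simp
  qed
  have rt: "1 - r \<le> t" using exp_ge_add_one_self[of "- t"] by (simp add: r_def)
  have u: "\<theta>\<^sup>2 / 18 \<le> u" using one_minus_cos_ge[OF \<theta>] by (simp add: u_def)
  then have u0: "u \<ge> 0" using order.trans[of 0 "\<theta>\<^sup>2 / 18" u] by simp
  \<comment> \<open>27 = 18 * 3 / 2, with 18 from the cosine bound and 2 / 3 a lower bound of 2 * r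
    * (1 + r) when r \<ge> 1 / 3.\<close>
  have "\<theta>\<^sup>2 / (27 * (t * (t\<^sup>2 + \<theta>\<^sup>2))) = 2 / 3 * ((\<theta>\<^sup>2 / 18) / (t * (t\<^sup>2 + \<theta>\<^sup>2)))" by simp
  also have "\<dots> \<le> 2 / 3 * (u / (t * (t\<^sup>2 + 2 * u)))"
  proof (rule mult_left_mono)
    have "(\<theta>\<^sup>2 / 18) * (t\<^sup>2 + 2 * u) \<le> u * (t\<^sup>2 + \<theta>\<^sup>2)"
    proof -
      have "(\<theta>\<^sup>2 / 18) * t\<^sup>2 \<le> u * t\<^sup>2" using u by (intro mult_right_mono) auto
      moreover have "(\<theta>\<^sup>2 / 18) * (2 * u) \<le> u * \<theta>\<^sup>2" using u0 by simp
      ultimately show ?thesis by (simp only: distrib_left)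
    qed
    moreover have "t\<^sup>2 + 2 * u > 0" "t\<^sup>2 + \<theta>\<^sup>2 > 0" using t u0 by (simp_all add: add_pos_nonneg)
    ultimately have "(\<theta>\<^sup>2 / 18) / (t\<^sup>2 + \<theta>\<^sup>2) \<le> u / (t\<^sup>2 + 2 * u)"
      by (simp add: divide_simps) (simp add: algebra_simps)
    then have "(\<theta>\<^sup>2 / 18) / (t\<^sup>2 + \<theta>\<^sup>2) / t \<le> u / (t\<^sup>2 + 2 * u) / t"
      using t by (intro divide_right_mono) auto
    then show "(\<theta>\<^sup>2 / 18) / (t * (t\<^sup>2 + \<theta>\<^sup>2)) \<le> u / (t * (t\<^sup>2 + 2 * u))"
      by (simp only: divide_divide_eq_left mult.commute[of t])
  qed simp
  also have "\<dots> = (2 / 3) * u / (t * (t\<^sup>2 + 2 * u))" by simp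
  also have "\<dots> \<le> (2 * (r * (1 + r))) * u / ((1 - r) * ((1 - r)\<^sup>2 + 2 * r * u))"
  proof (rule frac_le)
    have "2 * (1 / 3 * 1) \<le> 2 * (r * (1 + r))" using r3 by (intro mult_left_mono mult_mono) auto
    then show "2 / 3 * u \<le> 2 * (r * (1 + r)) * u" using u0 by (intro mult_right_mono) auto
    show "0 < (1 - r) * ((1 - r)\<^sup>2 + 2 * r * u)" using r u0 by (simp add: add_pos_nonneg)
    have "(1 - r)\<^sup>2 \<le> t\<^sup>2" using r rt by (intro power_mono) auto
    moreover have "2 * r * u \<le> 2 * 1 * u" using r u0 by (intro mult_right_mono mult_left_mono) auto
    ultimately have "(1 - r)\<^sup>2 + 2 * r * u \<le> t\<^sup>2 + 2 * u" by linarith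
    then show "(1 - r) * ((1 - r)\<^sup>2 + 2 * r * u) \<le> t * (t\<^sup>2 + 2 * u)"
      using rt r t u0 by (intro mult_mono) auto
  qed (use r u0 in auto)
  finally show ?thesis
    using Re_ovp_log_le[OF r, of \<theta>] unfolding u_def r_def by (simp add: mult.assoc)
qed

text \<open>The exponent D never exceeds 1 / (27 * t), but t ^ 3 * y \<le> 16 forces it to grow at
  least like the cube root of \<open>y\<close>, so its cube reaches a multiple of \<open>y\<close>.
  For y > 1, (1 + t * y) ^ 3 \<le> 4 * (1 + 16 * y^2) \<le> 68 * y^2 and exp D \<ge> (D / 3) ^ 3
  give the constant 68 * 81 ^ 3 = 68 * 27 ^ 4, doubled because 1 + y \<le> 2 * y. The 16 reflects an
  angle of modulus below 4.\<close>

lemma one_plus_le_exp: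
  fixes t y :: real
  assumes t: "t > 0" and y: "y \<ge> 0" and ty: "t ^ 3 * y \<le> 16"
  shows "1 + y \<le> 136 * 27 ^ 4 * exp (y / (27 * (1 + t * y)))"
proof -
  define D where "D = y / (27 * (1 + t * y))"
  have D: "D \<ge> 0" using t y by (simp add: D_def)
  show ?thesis
  proof (cases "y \<le> 1")
    case True
    have "1 + y \<le> 136 * 27 ^ 4 * 1" using True by simp
    also have "\<dots> \<le> 136 * 27 ^ 4 * exp D" using D by (intro mult_left_mono) auto
    finally have "1 + y \<le> 136 * 27 ^ 4 * exp D" .
    then show ?thesis by (simp only: D_def)
  next
    case False
    have p: "1 + t * y > 0" using t y by (simp add: add_pos_nonneg)
    have "(1 + t * y) ^ 3 \<le> 4 * (1 + (t * y) ^ 3)"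
    proof -
      define z where "z = t * y"
      have z: "z \<ge> 0" using t y by (simp add: z_def)
      have "4 * (1 + z ^ 3) - (1 + z) ^ 3 = 3 * (z - 1) ^ 2 * (z + 1)"
        by (simp add: power3_eq_cube power2_eq_square algebra_simps)
      moreover have "3 * (z - 1) ^ 2 * (z + 1) \<ge> 0" using z by simp
      ultimately have "(1 + z) ^ 3 \<le> 4 * (1 + z ^ 3)" by linarith
      then show ?thesis by (simp only: z_def)
    qed
    also have "(t * y) ^ 3 = (t ^ 3 * y) * y\<^sup>2" by (simp add: power3_eq_cube power2_eq_square)
    also have "\<dots> \<le> 16 * y\<^sup>2" using ty by (intro mult_right_mono) auto
    also have "4 * (1 + 16 * y\<^sup>2) \<le> 68 * y\<^sup>2" using False one_le_power[of y 2] by simp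
    finally have cube: "(1 + t * y) ^ 3 \<le> 68 * y\<^sup>2" by simp
    have "y / (68 * 27 ^ 4) = y ^ 3 / (68 * y\<^sup>2 * 27 ^ 4)"
      using False by (simp add: power3_eq_cube power2_eq_square)
    also have "\<dots> \<le> y ^ 3 / ((1 + t * y) ^ 3 * 27 ^ 4)"
      using cube y p False by (intro divide_left_mono mult_right_mono mult_pos_pos) auto
    also have "\<dots> = (D / 3) ^ 3"
    proof -
      have "D / 3 = y / ((1 + t * y) * 81)" by (simp add: D_def mult.commute)
      then show ?thesis by (simp only: power_divide power_mult_distrib) simp
    qed
    also have "\<dots> \<le> (exp (D / 3)) ^ 3"
    proof (rule power_mono)
      show "D / 3 \<le> exp (D / 3)" using exp_ge_add_one_self[of "D / 3"] by linarith
    qed (use D in simp)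
    also have "\<dots> = exp D" by (simp add: exp_of_nat_mult[symmetric])
    finally have "y \<le> 68 * 27 ^ 4 * exp D" by simp
    then have "1 + y \<le> 136 * 27 ^ 4 * exp D" using False by simp
    then show ?thesis by (simp only: D_def)
  qed
qed

theorem ovp_local_dominated:
  assumes t: "0 < t" "t \<le> 1" and v: "\<bar>t * sqrt t * v\<bar> \<le> pi"
  shows "norm (exp (ovp_local t (t * sqrt t * v))) \<le> 136 * 27 ^ 4 * inverse (1 + v\<^sup>2)"
proof -
  define \<theta> where "\<theta> = t * sqrt t * v"
  have sq: "\<theta>\<^sup>2 = t ^ 3 * v\<^sup>2" using t by (simp add: \<theta>_def power_mult_distrib power2_eq_square power3_eq_cube)
  have "\<theta>\<^sup>2 = \<bar>\<theta>\<bar>\<^sup>2" by simp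
  also have "\<dots> \<le> 4\<^sup>2" using v pi_less_4 unfolding \<theta>_def by (intro power_mono) auto
  finally have ty: "t ^ 3 * v\<^sup>2 \<le> 16" by (simp add: sq)
  have "norm (exp (ovp_local t \<theta>)) = exp (Re (ovp_log (of_real (exp (- t)) * cis \<theta>)) - ovp_log (exp (- t)))"
    by (simp add: ovp_local_def)
  also have "\<dots> \<le> exp (- (\<theta>\<^sup>2 / (27 * (t * (t\<^sup>2 + \<theta>\<^sup>2)))))"
    using Re_ovp_log_le_exp[OF t, of \<theta>] v by (simp add: \<theta>_def)
  also have "\<theta>\<^sup>2 / (27 * (t * (t\<^sup>2 + \<theta>\<^sup>2))) = v\<^sup>2 / (27 * (1 + t * v\<^sup>2))"
  proof -
    have "27 * (t * (t\<^sup>2 + \<theta>\<^sup>2)) = t ^ 3 * (27 * (1 + t * v\<^sup>2))"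
      unfolding sq by (simp add: power3_eq_cube power2_eq_square algebra_simps)
    then show ?thesis using t by (simp add: sq)
  qed
  also have "exp (- (v\<^sup>2 / (27 * (1 + t * v\<^sup>2)))) \<le> 136 * 27 ^ 4 * inverse (1 + v\<^sup>2)"
  proof -
    have "1 + v\<^sup>2 > 0" by (simp add: add_pos_nonneg)
    then show ?thesis
      using one_plus_le_exp[OF t(1) _ ty] by (simp add: exp_minus field_simps)
  qed
  finally show ?thesis by (simp add: \<theta>_def)
qed

section \<open>Coefficient extraction\<close>

lemma integral_cis_period:
  fixes k :: real
  assumes k: "k \<in> \<int>" "k \<noteq> 0"
  shows "has_bochner_integral lborel (\<lambda>\<theta>. indicator {-pi..pi} \<theta> *\<^sub>R cis (k * \<theta>)) 0"
proof -
  let ?F = "\<lambda>\<theta>. cis (k * \<theta>) / (\<i> * of_real k)"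
  have "has_bochner_integral lborel (\<lambda>\<theta>. indicator {-pi..pi} \<theta> *\<^sub>R cis (k * \<theta>)) (?F pi - ?F (- pi))"
  proof (rule has_bochner_integral_FTC_Icc)
    fix \<theta> :: real
    have "((\<lambda>\<theta>. exp (\<i> * of_real k * of_real \<theta>) / (\<i> * of_real k)) has_vector_derivative
        exp (\<i> * of_real k * of_real \<theta>)) (at \<theta> within {-pi..pi})"
    proof -
      have "((\<lambda>z. exp (\<i> * of_real k * z) / (\<i> * of_real k)) has_field_derivative
          exp (\<i> * of_real k * of_real \<theta>)) (at (of_real \<theta>))"
        using k by (auto intro!: derivative_eq_intros)
      from has_vector_derivative_real_field[OF this] show ?thesis
        by (rule has_vector_derivative_at_within)
    qed
    then show "(?F has_vector_derivative cis (k * \<theta>)) (at \<theta> within {-pi..pi})"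
      by (simp add: cis_conv_exp mult_ac)
    show "continuous_on {-pi..pi} (\<lambda>\<theta>. cis (k * \<theta>))" by (intro continuous_intros)
  qed (use pi_ge_zero in linarith)
  moreover have "cis (k * pi) = cis (k * - pi)"
  proof -
    have "cis (k * pi) = cis (k * - pi) * cis (2 * pi * k)"
      by (simp add: cis_mult algebra_simps)
    also have "cis (2 * pi * k) = 1" using k by (intro cis_multiple_2pi)
    finally show ?thesis by simp
  qed
  ultimately show ?thesis by simp
qed

lemma fourier_coefficient:
  fixes a :: "nat \<Rightarrow> complex"
  assumes a: "summable (\<lambda>m. norm (a m))"
  shows "(\<integral>\<theta>. indicator {-pi..pi} \<theta> *\<^sub>R ((\<Sum>m. a m * cis (real m * \<theta>)) * cis (- (real n * \<theta>))) \<partial>lborel) =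
    of_real (2 * pi) * a n"
proof -
  let ?f = "\<lambda>m \<theta>. a m * (indicator {-pi..pi} \<theta> *\<^sub>R cis ((real m - real n) * \<theta>))"
  have I: "has_bochner_integral lborel (?f m) (if m = n then of_real (2 * pi) * a n else 0)" for m
  proof (cases "m = n")
    case True
    have "has_bochner_integral lborel (\<lambda>\<theta>. indicator {-pi..pi} \<theta> *\<^sub>R (1 :: complex)) (measure lborel {-pi..pi} *\<^sub>R 1)"
      by (intro has_bochner_integral_indicator) auto
    then have "has_bochner_integral lborel (\<lambda>\<theta>. a m * (indicator {-pi..pi} \<theta> *\<^sub>R (1 :: complex))) (a m * (measure lborel {-pi..pi} *\<^sub>R 1))"
      by (rule has_bochner_integral_mult_right)
    then show ?thesis using True by (simp add: scaleR_conv_of_real mult_ac)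
  next
    case False
    have "has_bochner_integral lborel (?f m) (a m * 0)"
      using False by (intro has_bochner_integral_mult_right integral_cis_period) auto
    then show ?thesis using False by simp
  qed
  have nrm: "norm (?f m \<theta>) = norm (a m) * indicator {-pi..pi} \<theta>" for m \<theta>
    by (simp add: norm_mult)
  have "(\<integral>\<theta>. (\<Sum>m. ?f m \<theta>) \<partial>lborel) = (\<Sum>m. integral\<^sup>L lborel (?f m))"
  proof (rule integral_suminf)
    show "integrable lborel (?f m)" for m using I by (auto simp: has_bochner_integral_iff)
    show "AE \<theta> in lborel. summable (\<lambda>m. norm (?f m \<theta>))"
      unfolding nrm by (intro AE_I2 summable_mult2 a)
    show "summable (\<lambda>m. \<integral>\<theta>. norm (?f m \<theta>) \<partial>lborel)"
      unfolding nrm using a by (simp add: summable_mult2)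
  qed
  also have "(\<Sum>m. integral\<^sup>L lborel (?f m)) = (\<Sum>m. if m = n then of_real (2 * pi) * a n else 0)"
    using I by (simp add: has_bochner_integral_iff)
  also have "\<dots> = of_real (2 * pi) * a n"
    using sums_single[of n "\<lambda>_. of_real (2 * pi) * a n"] by (simp add: sums_iff)
  also have "(\<lambda>\<theta>. \<Sum>m. ?f m \<theta>) =
      (\<lambda>\<theta>. indicator {-pi..pi} \<theta> *\<^sub>R ((\<Sum>m. a m * cis (real m * \<theta>)) * cis (- (real n * \<theta>))))"
  proof
    fix \<theta>
    have s: "summable (\<lambda>m. a m * cis (real m * \<theta>))"
      by (rule summable_norm_cancel) (simp add: norm_mult a)
    have "?f m \<theta> = (a m * cis (real m * \<theta>)) * (indicator {-pi..pi} \<theta> *\<^sub>R cis (- (real n * \<theta>)))" for m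
      by (simp add: cis_mult left_diff_distrib)
    then have "(\<Sum>m. ?f m \<theta>) =
        (\<Sum>m. (a m * cis (real m * \<theta>)) * (indicator {-pi..pi} \<theta> *\<^sub>R cis (- (real n * \<theta>))))"
      by (rule suminf_cong)
    also have "\<dots> = (\<Sum>m. a m * cis (real m * \<theta>)) * (indicator {-pi..pi} \<theta> *\<^sub>R cis (- (real n * \<theta>)))"
      by (rule suminf_mult2[OF s, symmetric])
    finally show "(\<Sum>m. ?f m \<theta>) = indicator {-pi..pi} \<theta> *\<^sub>R ((\<Sum>m. a m * cis (real m * \<theta>)) * cis (- (real n * \<theta>)))"
      by simp
  qed
  finally show ?thesis .
qed

text \<open>Cauchy's formula with the angle \<theta> = t * sqrt t * v, the factor t * sqrt t being
  the Jacobian. The hypothesis on \<open>n\<close> is the saddle point condition; through it cis (-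
  n * \<theta>) is absorbed into \<open>ovp_local\<close> exactly, for every \<theta>.\<close>

lemma ovp_count_integral:
  assumes t: "t > 0" and n: "real n = pi\<^sup>2 / (4 * t\<^sup>2)"
  shows "complex_of_real (2 * pi * real (ovp_count positive_parts n) * exp (- (real n * t)) / exp (ovp_log (exp (- t))) / (t * sqrt t)) =
    (\<integral>v. indicator {-pi..pi} (t * sqrt t * v) *\<^sub>R exp (ovp_local t (t * sqrt t * v)) \<partial>lborel)"
proof -
  let ?x = "exp (- t)" and ?p = "\<lambda>m. ovp_count positive_parts m" and ?s = "t * sqrt t"
  let ?g = "\<lambda>\<theta>. indicator {-pi..pi} \<theta> *\<^sub>R exp (ovp_local t \<theta>)"
  have e: "?x ^ m = exp (- (real m * t))" for m
    by (subst exp_of_nat_mult[symmetric]) simp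
  have summ: "summable (\<lambda>m. norm (complex_of_real (real (?p m) * ?x ^ m)))"
  proof -
    have "norm (complex_of_real (real (?p m) * ?x ^ m)) = real (?p m) * ?x ^ m" for m
      by (simp only: norm_of_real) simp
    then show ?thesis using summable_ovp_count[of ?x] t by simp
  qed
  have gf: "(\<Sum>m. complex_of_real (real (?p m) * ?x ^ m) * cis (real m * \<theta>)) * cis (- (real n * \<theta>)) =
      of_real (exp (ovp_log ?x)) * exp (ovp_local t \<theta>)" for \<theta>
  proof -
    let ?q = "of_real ?x * cis \<theta>"
    have "(\<lambda>m. of_nat (?p m) * ?q ^ m) sums exp (ovp_log ?q)"
      using t by (intro ovp_count_sums) (simp add: norm_mult)
    moreover have "of_nat (?p m) * ?q ^ m = complex_of_real (real (?p m) * ?x ^ m) * cis (real m * \<theta>)" for m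
      by (simp add: power_mult_distrib Complex.DeMoivre)
    ultimately have "(\<Sum>m. complex_of_real (real (?p m) * ?x ^ m) * cis (real m * \<theta>)) = exp (ovp_log ?q)"
      by (simp only: sums_iff)
    moreover have "of_real (exp (ovp_log ?x)) * exp (ovp_local t \<theta>) = exp (ovp_log ?q) * cis (- (real n * \<theta>))"
      unfolding ovp_local_def n[symmetric] cis_conv_exp exp_of_real[symmetric] exp_add[symmetric]
      by (simp add: algebra_simps)
    ultimately show ?thesis by simp
  qed
  have "(\<integral>\<theta>. of_real (exp (ovp_log ?x)) * ?g \<theta> \<partial>lborel) = of_real (2 * pi) * complex_of_real (real (?p n) * ?x ^ n)"
    using fourier_coefficient[OF summ, of n] unfolding gf by (simp add: mult_ac)
  then have "of_real (exp (ovp_log ?x)) * (\<integral>\<theta>. ?g \<theta> \<partial>lborel) = of_real (2 * pi) * complex_of_real (real (?p n) * ?x ^ n)"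
    by (simp only: integral_mult_right_zero)
  then have "(\<integral>\<theta>. ?g \<theta> \<partial>lborel) = of_real (2 * pi * (real (?p n) * ?x ^ n) / exp (ovp_log ?x))"
    by (simp add: field_simps flip: exp_of_real)
  moreover have "(\<integral>\<theta>. ?g \<theta> \<partial>lborel) = ?s *\<^sub>R (\<integral>v. ?g (?s * v) \<partial>lborel)"
    using t lborel_integral_real_affine[of ?s ?g 0] by simp
  ultimately have "?s *\<^sub>R (\<integral>v. ?g (?s * v) \<partial>lborel) = of_real (2 * pi * (real (?p n) * ?x ^ n) / exp (ovp_log ?x))"
    by simp
  then have "(\<integral>v. ?g (?s * v) \<partial>lborel) = of_real (1 / ?s) * of_real (2 * pi * (real (?p n) * ?x ^ n) / exp (ovp_log ?x))"
    using t by (simp add: scaleR_conv_of_real field_simps)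
  then show ?thesis unfolding e of_real_mult[symmetric] by (simp add: mult_ac)
qed

lemma measurable_cis [measurable]: "cis \<in> borel_measurable borel"
  by (intro borel_measurable_continuous_onI continuous_intros)

lemma measurable_ovp_local [measurable]: "ovp_local t \<in> borel_measurable borel"
  unfolding ovp_local_def[abs_def] ovp_log_def by measurable

lemma gaussian_integral:
  "(\<integral>v. exp (- (pi\<^sup>2 / 4 * v\<^sup>2)) \<partial>lborel) = 2 / sqrt pi"
proof -
  \<comment> \<open>A centred normal density has exponent - v^2 / (2 * \<sigma>^2), which is - pi^2
    / 4 * v^2 for this \<sigma>.\<close>
  define \<sigma> where "\<sigma> = sqrt 2 / pi"
  have \<sigma>_pos: "\<sigma> > 0" by (simp add: \<sigma>_def)
  have \<sigma>: "\<sigma>\<^sup>2 = 2 / pi\<^sup>2" by (simp add: \<sigma>_def power_divide)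
  have c: "sqrt (2 * pi * \<sigma>\<^sup>2) = 2 / sqrt pi"
  proof -
    have "2 * pi * \<sigma>\<^sup>2 = 4 / pi" unfolding \<sigma> by (simp add: power2_eq_square)
    then show ?thesis by (simp add: real_sqrt_divide)
  qed
  have density: "normal_density 0 \<sigma> v = 1 / (2 / sqrt pi) * exp (- (pi\<^sup>2 / 4 * v\<^sup>2))" for v
    unfolding normal_density_def c by (simp add: \<sigma> mult.commute)
  have "(\<integral>v. 1 / (2 / sqrt pi) * exp (- (pi\<^sup>2 / 4 * v\<^sup>2)) \<partial>lborel) = 1"
    using integral_normal_density[of \<sigma> 0] unfolding density by (simp only: \<sigma>_pos)
  then have "1 / (2 / sqrt pi) * (\<integral>v. exp (- (pi\<^sup>2 / 4 * v\<^sup>2)) \<partial>lborel) = 1"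
    by (simp only: integral_mult_right_zero)
  then show ?thesis by (simp add: field_simps)
qed

lemma local_integral_tendsto:
  assumes T: "filterlim T (at_right 0) sequentially" and T1: "\<And>i. 0 < T i \<and> T i \<le> 1"
  shows "(\<lambda>i. \<integral>v. indicator {-pi..pi} (T i * sqrt (T i) * v) *\<^sub>R
      exp (ovp_local (T i) (T i * sqrt (T i) * v)) \<partial>lborel) \<longlonglongrightarrow> of_real (2 / sqrt pi)"
proof -
  let ?s = "\<lambda>i v. indicator {-pi..pi} (T i * sqrt (T i) * v) *\<^sub>R exp (ovp_local (T i) (T i * sqrt (T i) * v))"
  let ?C = "136 * 27 ^ 4 :: real"
  have "(\<lambda>i. integral\<^sup>L lborel (?s i)) \<longlonglongrightarrow> (\<integral>v. complex_of_real (exp (- (pi\<^sup>2 / 4 * v\<^sup>2))) \<partial>lborel)"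
  proof (rule integral_dominated_convergence[where w = "\<lambda>v. ?C * inverse (1 + v\<^sup>2)"])
    show "integrable lborel (\<lambda>v. ?C * inverse (1 + v\<^sup>2))"
      using integrable_inverse_1_plus_square
      by (intro integrable_mult_right) (simp add: set_integrable_def einterval_def)
    show "AE v in lborel. (\<lambda>i. ?s i v) \<longlonglongrightarrow> of_real (exp (- (pi\<^sup>2 / 4 * v\<^sup>2)))"
    proof (intro AE_I2)
      fix v :: real
      have "((\<lambda>t. exp (ovp_local t (t * sqrt t * v))) \<longlongrightarrow> exp (of_real (- (pi\<^sup>2 / 4 * v\<^sup>2)))) (at_right 0)"
        by (intro tendsto_exp ovp_local_tendsto)
      then have "(\<lambda>i. exp (ovp_local (T i) (T i * sqrt (T i) * v))) \<longlonglongrightarrow> exp (of_real (- (pi\<^sup>2 / 4 * v\<^sup>2)))"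
        by (rule filterlim_compose[OF _ T])
      \<comment> \<open>For fixed \<open>v\<close> the rescaled angle eventually lies within the
        period, where the indicator is 1.\<close>
      moreover have "\<forall>\<^sub>F i in sequentially. exp (ovp_local (T i) (T i * sqrt (T i) * v)) = ?s i v"
      proof -
        have "((\<lambda>t. t * sqrt t) \<longlongrightarrow> 0) (at_right 0)" by real_asymp
        from filterlim_compose[OF this T] have "(\<lambda>i. T i * sqrt (T i)) \<longlonglongrightarrow> 0" .
        from tendsto_mult_left_zero[OF this, of v] have "(\<lambda>i. T i * sqrt (T i) * v) \<longlonglongrightarrow> 0" .
        from tendstoD[OF this pi_gt_zero] show ?thesis
          by eventually_elim (auto simp: indicator_def)
      qed
      ultimately show "(\<lambda>i. ?s i v) \<longlonglongrightarrow> of_real (exp (- (pi\<^sup>2 / 4 * v\<^sup>2)))"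
        using Lim_transform_eventually by (fastforce simp only: exp_of_real)
    qed
    show "AE v in lborel. norm (?s i v) \<le> ?C * inverse (1 + v\<^sup>2)" for i
    proof (intro AE_I2)
      fix v :: real
      show "norm (?s i v) \<le> ?C * inverse (1 + v\<^sup>2)"
      proof (cases "T i * sqrt (T i) * v \<in> {-pi..pi}")
        case True
        then have "\<bar>T i * sqrt (T i) * v\<bar> \<le> pi" by auto
        then show ?thesis using ovp_local_dominated[of "T i" v] T1[of i] True by simp
      next
        case False
        then have "indicator {-pi..pi} (T i * sqrt (T i) * v) = (0 :: real)"
          by (rule indicator_simps(2))
        then show ?thesis by (simp add: add_nonneg_nonneg)
      qed
    qed
  qed measurable
  also have "(\<integral>v. complex_of_real (exp (- (pi\<^sup>2 / 4 * v\<^sup>2))) \<partial>lborel) = of_real (2 / sqrt pi)"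
    unfolding gaussian_integral[symmetric] by (rule integral_complex_of_real)
  finally show ?thesis .
qed

theorem ovp_count_asymptotics:
  "(\<lambda>n. real (ovp_count positive_parts n) / (exp (pi * sqrt (real n)) / (8 * real n))) \<longlonglongrightarrow> 1"
proof (rule LIMSEQ_offset[where k = 3])
  define T where "T i = pi / (2 * sqrt (real (i + 3)))" for i :: nat
  define J where "J i = 2 * pi * real (ovp_count positive_parts (i + 3)) * exp (- (real (i + 3) * T i))
      / exp (ovp_log (exp (- T i))) / (T i * sqrt (T i))" for i
  define \<eta> where "\<eta> t = ovp_log (exp (- t)) - pi\<^sup>2 / (4 * t) - ln (t / (4 * pi)) / 2" for t
  have T: "filterlim T (at_right 0) sequentially" unfolding T_def by real_asymp
  have T0: "T i > 0" for i by (simp add: T_def)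
  have Tsq: "(T i)\<^sup>2 = pi\<^sup>2 / (4 * real (i + 3))" for i
    by (simp add: T_def power_divide power_mult_distrib)
  \<comment> \<open>This is the reason for the shift by 3: the majorant of the integrand requires t
    \<le> 1, and pi \<le> 2 * sqrt n holds from n = 3 on.\<close>
  have T1: "T i \<le> 1" for i
  proof -
    have "pi \<le> 2 * sqrt 3"
    proof -
      have "pi < 3.2" using pi_approx by simp
      moreover have "1.6 \<le> sqrt 3" by (rule real_le_rsqrt) (simp add: power2_eq_square)
      ultimately show ?thesis by simp
    qed
    also have "2 * sqrt 3 \<le> 2 * sqrt (real (i + 3))" by simp
    finally show ?thesis by (simp add: T_def)
  qed
  have n_eq: "real (i + 3) = pi\<^sup>2 / (4 * (T i)\<^sup>2)" for i
    unfolding Tsq by simp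
  have "(\<lambda>i. complex_of_real (J i)) \<longlonglongrightarrow> of_real (2 / sqrt pi)"
    unfolding J_def ovp_count_integral[OF T0 n_eq] using T0 T1 by (intro local_integral_tendsto T) auto
  then have J: "J \<longlonglongrightarrow> 2 / sqrt pi" by (simp only: tendsto_of_real_iff)
  have "(\<lambda>i. \<eta> (T i)) \<longlonglongrightarrow> 0"
    using ovp_log_asymptotics unfolding \<eta>_def[symmetric] by (rule filterlim_compose[OF _ T])
  then have "(\<lambda>i. J i * exp (\<eta> (T i)) * (sqrt pi / 2)) \<longlonglongrightarrow> 2 / sqrt pi * exp 0 * (sqrt pi / 2)"
    by (intro tendsto_intros J)
  then have lim: "(\<lambda>i. J i * exp (\<eta> (T i)) * (sqrt pi / 2)) \<longlonglongrightarrow> 1" by simp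
  have "real (ovp_count positive_parts (i + 3)) / (exp (pi * sqrt (real (i + 3))) / (8 * real (i + 3))) =
      J i * exp (\<eta> (T i)) * (sqrt pi / 2)" for i
  proof -
    define t where "t = T i"
    define N where "N = real (i + 3)"
    define P where "P = real (ovp_count positive_parts (i + 3))"
    have t: "t > 0" using T0 by (simp add: t_def)
    have N: "N > 0" by (simp add: N_def)
    have tN: "t = pi / (2 * sqrt N)" by (simp add: t_def N_def T_def)
    have t2: "t * t = pi * pi / (4 * N)" using Tsq[of i] by (simp add: t_def N_def power2_eq_square)
    have a: "N * t = pi * sqrt N / 2"
      using N by (simp add: tN) (simp add: field_simps)
    have b: "pi\<^sup>2 / (4 * t) = pi * sqrt N / 2"
      using N by (simp add: tN power2_eq_square)
    have "exp (\<eta> t) = exp (ovp_log (exp (- t))) / (exp (pi\<^sup>2 / (4 * t)) * sqrt (t / (4 * pi)))"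
    proof -
      have "exp (ln (t / (4 * pi)) / 2) = sqrt (t / (4 * pi))"
        using t by (simp add: ln_sqrt[symmetric])
      then show ?thesis by (simp add: \<eta>_def exp_diff)
    qed
    then have "J i * exp (\<eta> t) = 2 * pi * P * exp (- (N * t)) / (t * sqrt t) / (exp (pi\<^sup>2 / (4 * t)) * sqrt (t / (4 * pi)))"
      by (simp add: J_def t_def N_def P_def)
    also have "\<dots> = 2 * pi * P / (exp (N * t) * exp (pi\<^sup>2 / (4 * t))) / (t * (sqrt t * sqrt (t / (4 * pi))))"
      by (simp add: exp_minus field_simps)
    also have "exp (N * t) * exp (pi\<^sup>2 / (4 * t)) = exp (pi * sqrt N)"
      unfolding a b exp_add[symmetric] by simp
    also have "sqrt t * sqrt (t / (4 * pi)) = t / (2 * sqrt pi)"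
      using t by (simp add: real_sqrt_divide real_sqrt_mult)
    also have "t * (t / (2 * sqrt pi)) = (t * t) / (2 * sqrt pi)" by simp
    also have "\<dots> = pi * pi / (8 * N * sqrt pi)" unfolding t2 by simp
    finally have "J i * exp (\<eta> t) = 2 * pi * P / exp (pi * sqrt N) / (pi * pi / (8 * N * sqrt pi))" .
    \<comment> \<open>With s = sqrt pi the identity becomes one between rational functions.\<close>
    moreover have "2 * (s * s) * P / E / ((s * s) * (s * s) / (8 * N * s)) * (s / 2) = P / (E / (8 * N))"
      if "s > 0" "E > 0" for s E :: real
      using that N by (simp add: field_simps)
    from this[of "sqrt pi" "exp (pi * sqrt N)"]
    have "2 * pi * P / exp (pi * sqrt N) / (pi * pi / (8 * N * sqrt pi)) * (sqrt pi / 2) =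
        P / (exp (pi * sqrt N) / (8 * N))" by simp
    ultimately have "J i * exp (\<eta> t) * (sqrt pi / 2) = P / (exp (pi * sqrt N) / (8 * N))" by (simp only:)
    then show ?thesis by (simp add: t_def N_def P_def)
  qed
  then show "(\<lambda>i. real (ovp_count positive_parts (i + 3)) / (exp (pi * sqrt (real (i + 3))) / (8 * real (i + 3)))) \<longlonglongrightarrow> 1"
    using lim by (simp only:)
qed

section \<open>From the number of overpartitions to the sum of the mex\<close>

lemma eventually_ovp_count_pos: "\<forall>\<^sub>F n in sequentially. ovp_count positive_parts n > 0"
proof -
  have "\<forall>\<^sub>F n in sequentially. 0 < real (ovp_count positive_parts n) / (exp (pi * sqrt (real n)) / (8 * real n))"
    by (rule order_tendstoD(1)[OF ovp_count_asymptotics]) simp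
  then show ?thesis by eventually_elim (auto intro: gr0I)
qed

text \<open>The growth is subexponential: sqrt (n + m) - sqrt n tends to 0, so a fixed shift changes
  the asymptotic formula by a factor that tends to 1.\<close>

lemma ovp_count_shift_ratio:
  "(\<lambda>n. real (ovp_count positive_parts (n + m)) / real (ovp_count positive_parts n)) \<longlonglongrightarrow> 1"
proof -
  let ?p = "\<lambda>n. real (ovp_count positive_parts n)"
  define g where "g n = exp (pi * sqrt (real n)) / (8 * real n)" for n
  have p: "(\<lambda>n. ?p n / g n) \<longlonglongrightarrow> 1" unfolding g_def by (rule ovp_count_asymptotics)
  have "(\<lambda>n. g (n + m) / g n) \<longlonglongrightarrow> 1" unfolding g_def of_nat_add by real_asymp
  then have "(\<lambda>n. (?p (n + m) / g (n + m)) * (g (n + m) / g n) / (?p n / g n)) \<longlonglongrightarrow> 1 * 1 / 1"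
    by (intro tendsto_divide tendsto_mult LIMSEQ_ignore_initial_segment[OF p] p) auto
  moreover have "\<forall>\<^sub>F n in sequentially. (?p (n + m) / g (n + m)) * (g (n + m) / g n) / (?p n / g n) = ?p (n + m) / ?p n"
    using eventually_gt_at_top[of 0]
  proof eventually_elim
    case (elim n)
    have "g n > 0" "g (n + m) > 0" using elim by (simp_all add: g_def)
    then show ?case by simp
  qed
  ultimately show ?thesis using Lim_transform_eventually by fastforce
qed

text \<open>The two halving inequalities place twice the count for \<open>Suc m\<close> at n between
  the counts for \<open>m\<close> at n and at n + m + 1. These agree asymptotically, because a fixed
  shift of the argument does not matter.\<close>

lemma ovp_count_overlined_from_ratio:
  "(\<lambda>n. real (ovp_count (overlined_from m) n) / real (ovp_count positive_parts n)) \<longlonglongrightarrow> (1 / 2) ^ m"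
proof (induction m)
  case 0
  have "\<forall>\<^sub>F n in sequentially. 1 = real (ovp_count (overlined_from 0) n) / real (ovp_count positive_parts n)"
    using eventually_ovp_count_pos by eventually_elim simp
  then have "(\<lambda>n. real (ovp_count (overlined_from 0) n) / real (ovp_count positive_parts n)) \<longlonglongrightarrow> 1"
    by (rule Lim_transform_eventually[OF tendsto_const])
  then show ?case by simp
next
  case (Suc m)
  let ?p = "\<lambda>n. real (ovp_count positive_parts n)"
  let ?b = "\<lambda>m n. real (ovp_count (overlined_from m) n)"
  show ?case
  proof (rule tendsto_sandwich)
    show "\<forall>\<^sub>F n in sequentially. ?b m n / ?p n / 2 \<le> ?b (Suc m) n / ?p n"
    proof (intro always_eventually allI)
      fix n
      have "?b m n \<le> 2 * ?b (Suc m) n" using ovp_count_overlined_from_le[of m n] by linarith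
      then have "?b m n / ?p n \<le> (2 * ?b (Suc m) n) / ?p n" by (rule divide_right_mono) simp
      then show "?b m n / ?p n / 2 \<le> ?b (Suc m) n / ?p n" by simp
    qed
    show "\<forall>\<^sub>F n in sequentially. ?b (Suc m) n / ?p n \<le>
        (?b m (n + Suc m) / ?p (n + Suc m)) * (?p (n + Suc m) / ?p n) / 2"
      using sequentially_offset[OF eventually_ovp_count_pos, of "Suc m"]
    proof eventually_elim
      case (elim n)
      have "2 * ?b (Suc m) n \<le> ?b m (n + Suc m)" using twice_ovp_count_overlined_from_le[of m n] by linarith
      then have "(2 * ?b (Suc m) n) / ?p n \<le> ?b m (n + Suc m) / ?p n" by (rule divide_right_mono) simp
      then show ?case using elim by simp
    qed
    show "(\<lambda>n. ?b m n / ?p n / 2) \<longlonglongrightarrow> (1 / 2) ^ Suc m"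
      using tendsto_divide[OF Suc tendsto_const[of 2]] by simp
    have "(\<lambda>n. (?b m (n + Suc m) / ?p (n + Suc m)) * (?p (n + Suc m) / ?p n) / 2) \<longlonglongrightarrow> (1 / 2) ^ m * 1 / 2"
      by (intro tendsto_divide tendsto_mult LIMSEQ_ignore_initial_segment[OF Suc] ovp_count_shift_ratio tendsto_const) auto
    then show "(\<lambda>n. (?b m (n + Suc m) / ?p (n + Suc m)) * (?p (n + Suc m) / ?p n) / 2) \<longlonglongrightarrow> (1 / 2) ^ Suc m"
      by simp
  qed
qed

text \<open>Shifting n by 1 + ... + m selects the nonzero branch of
  \<open>card_initial_overlined\<close>; the quotient then differs from the one for
  \<open>overlined_from m\<close> only by a ratio of shifted counts.\<close>

lemma card_initial_overlined_ratio:
  "(\<lambda>n. real (card (initial_overlined m n)) / real (ovp_count positive_parts n)) \<longlonglongrightarrow> (1 / 2) ^ m"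
proof (rule LIMSEQ_offset[where k = "\<Sum>{1..m}"])
  let ?p = "\<lambda>n. real (ovp_count positive_parts n)"
  let ?k = "\<Sum>{1..m}"
  have "(\<lambda>n. (real (ovp_count (overlined_from m) n) / ?p n) / (?p (n + ?k) / ?p n)) \<longlonglongrightarrow> (1 / 2) ^ m / 1"
    by (intro tendsto_divide ovp_count_overlined_from_ratio ovp_count_shift_ratio) simp
  moreover have "\<forall>\<^sub>F n in sequentially. (real (ovp_count (overlined_from m) n) / ?p n) / (?p (n + ?k) / ?p n) =
      real (card (initial_overlined m (n + ?k))) / ?p (n + ?k)"
    using eventually_ovp_count_pos
  proof eventually_elim
    case (elim n)
    then show ?case by (simp add: card_initial_overlined)
  qed
  ultimately show "(\<lambda>n. real (card (initial_overlined m (n + ?k))) / ?p (n + ?k)) \<longlonglongrightarrow> (1 / 2) ^ m"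
    using Lim_transform_eventually by fastforce
qed

lemma sigma_overlined_mex_ratio:
  "(\<lambda>n. real (sigma_overlined_mex n) / real (ovp_count positive_parts n)) \<longlonglongrightarrow> 2"
proof -
  let ?p = "\<lambda>n. real (ovp_count positive_parts n)"
  have "(\<lambda>n. \<Sum>m. real (card (initial_overlined m n)) / ?p n) \<longlonglongrightarrow> (\<Sum>m. (1 / 2) ^ m)"
  proof (rule tannery_all)
    show "(\<lambda>n. real (card (initial_overlined m n)) / ?p n) \<longlonglongrightarrow> (1 / 2) ^ m" for m
      by (rule card_initial_overlined_ratio)
    show "summable (\<lambda>m. (1 / 2 :: real) ^ m)" by (rule summable_geometric) simp
    show "\<forall>\<^sub>F n in sequentially. \<forall>m. norm (real (card (initial_overlined m n)) / ?p n) \<le> (1 / 2) ^ m"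
      using eventually_ovp_count_pos
    proof eventually_elim
      case (elim n)
      show ?case
      proof
        fix m
        have "real (2 ^ m * card (initial_overlined m n)) \<le> ?p n"
          by (rule of_nat_mono[OF card_initial_overlined_le])
        then show "norm (real (card (initial_overlined m n)) / ?p n) \<le> (1 / 2) ^ m"
          using elim by (simp add: power_divide field_simps)
      qed
    qed
  qed simp
  moreover have "(\<Sum>m. real (card (initial_overlined m n)) / ?p n) = real (sigma_overlined_mex n) / ?p n" for n
  proof -
    \<comment> \<open>As m \<le> 1 + ... + m, no overpartition of \<open>n\<close> has 1, ..., m all
      overlined when m > n; hence the finite sum over m is a series to which dominated convergence
      applies.\<close>
    have "card (initial_overlined m n) = 0" if "m \<notin> {..n}" for m
    proof -
      have "m \<le> \<Sum>{1..m}" using that by (intro member_le_sum) auto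
      then show ?thesis using that by (simp add: card_initial_overlined)
    qed
    then have "(\<Sum>m. real (card (initial_overlined m n)) / ?p n) = (\<Sum>m\<le>n. real (card (initial_overlined m n)) / ?p n)"
      by (intro suminf_finite) auto
    then show ?thesis by (simp add: sigma_overlined_mex_eq sum_divide_distrib)
  qed
  moreover have "(\<Sum>m. (1 / 2 :: real) ^ m) = 2" by (subst suminf_geometric) simp_all
  ultimately show ?thesis by (simp only:)
qed

theorem theorem1p4:
  "(\<lambda>n::nat. real (sigma_overlined_mex n)) \<sim>[at_top]
     (\<lambda>n. exp (pi * sqrt (real n)) / (4 * real n))"
proof (rule asymp_equivI')
  let ?p = "\<lambda>n. real (ovp_count positive_parts n)"
  let ?g = "\<lambda>n. exp (pi * sqrt (real n)) / (8 * real n)"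
  have "(\<lambda>n. (real (sigma_overlined_mex n) / ?p n) * (?p n / ?g n) / 2) \<longlonglongrightarrow> 2 * 1 / 2"
    by (intro tendsto_divide tendsto_mult sigma_overlined_mex_ratio ovp_count_asymptotics tendsto_const) simp
  moreover have "\<forall>\<^sub>F n in sequentially. (real (sigma_overlined_mex n) / ?p n) * (?p n / ?g n) / 2 =
      real (sigma_overlined_mex n) / (exp (pi * sqrt (real n)) / (4 * real n))"
    using eventually_ovp_count_pos by eventually_elim simp
  ultimately show "(\<lambda>n. real (sigma_overlined_mex n) / (exp (pi * sqrt (real n)) / (4 * real n))) \<longlonglongrightarrow> 1"
    using Lim_transform_eventually by fastforce
qed

end
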